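(* Consider a linear ordinary differential equation $$\frac{du}{dx}=\Big(S+\sum_{i=1}^q\frac{A_i}{x-a_i}\Big)u,\qquad S,A_1,\dots,A_q\in \mathrm{Mat}(N,\mathbb C),\ N\ge 1,$$ with $a_1,\dots,a_q\in\mathbb C$ pairwise distinct and $S$ diagonalizable. Suppose that the equation is irreducible and non-exceptional. Then the following hold. (i) $\mathcal{ML}^{-1}\circ\mathcal{ML}=\mathcal{ML}\circ\mathcal{ML}^{-1}=\mathrm{id}$ on this equation, up to constant gauge equivalence; that is, the equations obtained from it by applying $\mathcal{ML}^{-1}\circ\mathcal{ML}$ and $\mathcal{ML}\circ\mathcal{ML}^{-1}$ coincide with the original one modulo a gauge transformation by a constant matrix $P\in\mathrm{GL}(N,\mathbb C)$. (ii) The equations obtained from it by the middle Laplace transform $\mathcal{ML}$ and by the inverse middle Laplace transform $\mathcal{ML}^{-1}$ are also irreducible and non-exceptional.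
   Context: For an equation $\frac{du}{dx}=\big(S+\sum_{i=1}^q\frac{A_i}{x-a_i}\big)u$ with $S$ diagonalizable: - It is irreducible if there is no subspace of $\mathbb C^N$ invariant under $S,A_1,\dots,A_q$ other than $\{0\}$ and $\mathbb C^N$. It is exceptional if $N=1$ and $A_i=0$ for all $i$; otherwise it is non-exceptional. - Let $\alpha_1,\dots,\alpha_{\hat q}$ be the distinct eigenvalues of $S$ and let $E_j$ be the projection onto $\mathrm{Ker}(S-\alpha_j)$ along the sum of the other eigenspaces, so $S=\sum_j\alpha_jE_j$. On $(\mathbb C^N)^q$ define $T(v_1,\dots,v_q)=(a_1v_1,\dots,a_qv_q)$ and, for $1\le j\le\hat q$, $B_j(v_1,\dots,v_q)=-(w_j,\dots,w_j)$ with $w_j=E_j\sum_{k=1}^qA_kv_k$. Put $\mathcal K=\bigoplus_{i=1}^q\mathrm{Ker}\,A_i\subset(\mathbb C^N)^q$; this subspace is invariant under $T,B_1,\dots,B_{\hat q}$. Let $\bar T,\bar B_1,\dots,\bar B_{\hat q}$ be matrices (in some basis) of the induced operators on $(\mathbb C^N)^q/\mathcal K$. - The middle Laplace transform $\mathcal{ML}$ sends the equation to $\frac{dv}{dx}=\big(-\bar T+\sum_{j=1}^{\hat q}\frac{\bar B_j}{x-\alpha_j}\big)v$. The inverse middle Laplace transform $\mathcal{ML}^{-1}$ sends it to $\frac{dw}{dx}=\big(\bar T+\sum_{j=1}^{\hat q}\frac{\bar B_j}{x+\alpha_j}\big)w$. The results are defined up to constant gauge transformation (choice of basis), and they are again equations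 of the same type (the matrices $\mp\bar T$ are diagonalizable), so that the transforms can be composed. - A gauge transformation by a constant $P\in\mathrm{GL}(N,\mathbb C)$ replaces $(S,A_1,\dots,A_q)$ by $(P^{-1}SP,P^{-1}A_1P,\dots,P^{-1}A_qP)$. *)

theory Defs
  imports "Jordan_Normal_Form.Matrix_Kernel" "Jordan_Normal_Form.Char_Poly"
begin

section \<open>Equations with an irregular singularity at infinity\<close>

text \<open>A record stands for \<open>du/dx = (S + \<Sum>k<q. A\<^sub>k / (x - a\<^sub>k)) u\<close> with
  \<open>S = lead_mat\<close>, \<open>a\<^sub>k = sing_pts ! k\<close>, \<open>A\<^sub>k = res_mats ! k\<close>.  The \<open>A\<^sub>k\<close> may vanish.\<close>

record equation =
  lead_mat :: "complex mat"
  sing_pts :: "complex list"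
  res_mats :: "complex mat list"

definition eq_size :: "equation \<Rightarrow> nat" where
  "eq_size e = dim_row (lead_mat e)"

definition num_pts :: "equation \<Rightarrow> nat" where
  "num_pts e = length (sing_pts e)"

definition diagonalizable_mat :: "complex mat \<Rightarrow> bool" where
  "diagonalizable_mat M \<longleftrightarrow> (\<exists>D. diagonal_mat D \<and> similar_mat M D)"

definition admissible :: "equation \<Rightarrow> bool" where
  "admissible e \<longleftrightarrow>
     eq_size e \<ge> 1 \<and>
     lead_mat e \<in> carrier_mat (eq_size e) (eq_size e) \<and>
     length (res_mats e) = num_pts e \<and>
     (\<forall>A \<in> set (res_mats e). A \<in> carrier_mat (eq_size e) (eq_size e)) \<and>
     distinct (sing_pts e) \<and>
     diagonalizable_mat (lead_mat e)"

definition irreducible_eq :: "equation \<Rightarrow> bool" where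
  "irreducible_eq e \<longleftrightarrow>
     (\<forall>W. VectorSpace.subspace class_ring W (module_vec TYPE(complex) (eq_size e)) \<and>
          (\<forall>M \<in> insert (lead_mat e) (set (res_mats e)). \<forall>w \<in> W. M *\<^sub>v w \<in> W)
        \<longrightarrow> W = {0\<^sub>v (eq_size e)} \<or> W = carrier_vec (eq_size e))"

definition exceptional :: "equation \<Rightarrow> bool" where
  "exceptional e \<longleftrightarrow>
     eq_size e = 1 \<and> (\<forall>A \<in> set (res_mats e). A = 0\<^sub>m (eq_size e) (eq_size e))"

section \<open>Constant gauge equivalence\<close>

definition coeff_mat :: "equation \<Rightarrow> complex \<Rightarrow> complex mat" where
  "coeff_mat e x = mat (eq_size e) (eq_size e) (\<lambda>(r, s).
     lead_mat e $$ (r, s) + (\<Sum>k<num_pts e. (res_mats e ! k) $$ (r, s) / (x - sing_pts e ! k)))"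

text \<open>Two records describe the same equation iff their coefficient functions agree: the order
  of the singular points and terms with zero residue do not matter.\<close>

definition same_eq :: "equation \<Rightarrow> equation \<Rightarrow> bool" where
  "same_eq e e' \<longleftrightarrow>
     (\<forall>x. x \<notin> set (sing_pts e) \<union> set (sing_pts e') \<longrightarrow> coeff_mat e x = coeff_mat e' x)"

text \<open>Below, \<open>Q\<close> is the inverse of \<open>P\<close>.\<close>

definition gauge :: "complex mat \<Rightarrow> complex mat \<Rightarrow> equation \<Rightarrow> equation" where
  "gauge Q P e = \<lparr> lead_mat = Q * lead_mat e * P, sing_pts = sing_pts e,
                   res_mats = map (\<lambda>A. Q * A * P) (res_mats e) \<rparr>"

definition gauge_equiv :: "equation \<Rightarrow> equation \<Rightarrow> bool" where
  "gauge_equiv e e' \<longleftrightarrow>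
     (\<exists>P Q. P \<in> carrier_mat (eq_size e) (eq_size e) \<and> Q \<in> carrier_mat (eq_size e) (eq_size e) \<and>
            inverts_mat P Q \<and> inverts_mat Q P \<and> same_eq (gauge Q P e) e')"

section \<open>The middle Laplace transform\<close>

text \<open>For diagonalizable \<open>S\<close> this is the projection onto \<open>Ker (S - \<alpha>)\<close> along the sum of the
  other eigenspaces; the conditions determine it because the eigenspaces span.\<close>

definition eigenproj :: "complex mat \<Rightarrow> complex \<Rightarrow> complex mat" where
  "eigenproj S \<alpha> = (THE E. E \<in> carrier_mat (dim_row S) (dim_row S) \<and>
     (\<forall>v \<in> carrier_vec (dim_row S). S *\<^sub>v v = \<alpha> \<cdot>\<^sub>v v \<longrightarrow> E *\<^sub>v v = v) \<and>
     (\<forall>\<beta>. \<beta> \<noteq> \<alpha> \<longrightarrow>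
        (\<forall>v \<in> carrier_vec (dim_row S). S *\<^sub>v v = \<beta> \<cdot>\<^sub>v v \<longrightarrow> E *\<^sub>v v = 0\<^sub>v (dim_row S))))"

text \<open>A tuple \<open>(v\<^sub>0, \<dots>, v\<^bsub>q-1\<^esub>)\<close> of vectors in \<open>\<complex>\<^sup>N\<close> is encoded as the concatenated vector in
  \<open>\<complex>\<^bsup>q N\<^esup>\<close>; \<open>block N v k\<close> is \<open>v\<^sub>k\<close>.\<close>

definition block :: "nat \<Rightarrow> complex vec \<Rightarrow> nat \<Rightarrow> complex vec" where
  "block N v k = vec N (\<lambda>r. v $ (k * N + r))"

definition tuple :: "nat \<Rightarrow> nat \<Rightarrow> (nat \<Rightarrow> complex vec) \<Rightarrow> complex vec" where
  "tuple q N f = vec (q * N) (\<lambda>i. f (i div N) $ (i mod N))"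

definition T_op :: "equation \<Rightarrow> complex vec \<Rightarrow> complex vec" where
  "T_op e v = tuple (num_pts e) (eq_size e) (\<lambda>k. (sing_pts e ! k) \<cdot>\<^sub>v block (eq_size e) v k)"

definition B_op :: "equation \<Rightarrow> complex \<Rightarrow> complex vec \<Rightarrow> complex vec" where
  "B_op e \<alpha> v =
     (let w = eigenproj (lead_mat e) \<alpha> *\<^sub>v
                finsum_vec TYPE(complex) (eq_size e)
                  (\<lambda>k. (res_mats e ! k) *\<^sub>v block (eq_size e) v k) {..<num_pts e}
      in tuple (num_pts e) (eq_size e) (\<lambda>k. - w))"

definition K_space :: "equation \<Rightarrow> complex vec set" where
  "K_space e = {v \<in> carrier_vec (num_pts e * eq_size e).
     \<forall>k<num_pts e. block (eq_size e) v k \<in> mat_kernel (res_mats e ! k)}"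

text \<open>The classes modulo \<open>K\<close> of the \<open>m\<close> columns of \<open>P\<close> form a basis of \<open>\<complex>\<^sup>n / K\<close>.\<close>

definition quotient_basis :: "nat \<Rightarrow> complex vec set \<Rightarrow> nat \<Rightarrow> complex mat \<Rightarrow> bool" where
  "quotient_basis n K m P \<longleftrightarrow>
     P \<in> carrier_mat n m \<and>
     (\<forall>v \<in> carrier_vec n. \<exists>!c. c \<in> carrier_vec m \<and> v - P *\<^sub>v c \<in> K)"

text \<open>\<open>M\<close> is the matrix, in that basis, of the operator induced by \<open>F\<close> on \<open>\<complex>\<^sup>n / K\<close>: its
  \<open>k\<close>-th column lists the coordinates of the class of the image of the \<open>k\<close>-th basis vector.\<close>

definition induced_mat ::
  "(complex vec \<Rightarrow> complex vec) \<Rightarrow> complex vec set \<Rightarrow> nat \<Rightarrow> complex mat \<Rightarrow> complex mat \<Rightarrow> bool" where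
  "induced_mat F K m P M \<longleftrightarrow>
     M \<in> carrier_mat m m \<and> (\<forall>k<m. F (col P k) - P *\<^sub>v col M k \<in> K)"

text \<open>\<open>\<alpha>s\<close> enumerates the distinct eigenvalues of \<open>S\<close>; \<open>Tb\<close> and \<open>Bs ! j\<close> are matrices, in one
  common basis of the quotient, of the operators induced by \<open>T\<close> and \<open>B\<^sub>j\<close>.\<close>

definition induced_data ::
  "equation \<Rightarrow> complex list \<Rightarrow> complex mat \<Rightarrow> complex mat list \<Rightarrow> bool" where
  "induced_data e \<alpha>s Tb Bs \<longleftrightarrow>
     distinct \<alpha>s \<and> set \<alpha>s = {\<alpha>. eigenvalue (lead_mat e) \<alpha>} \<and> length Bs = length \<alpha>s \<and>
     (\<exists>m P. quotient_basis (num_pts e * eq_size e) (K_space e) m P \<and>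
            induced_mat (T_op e) (K_space e) m P Tb \<and>
            (\<forall>j<length \<alpha>s. induced_mat (B_op e (\<alpha>s ! j)) (K_space e) m P (Bs ! j)))"

text \<open>The transforms are only defined up to a choice of basis (and of the order of the
  eigenvalues), so they are relations: \<open>mid_laplace e e'\<close> says that \<open>e'\<close> is a possible result.\<close>

definition mid_laplace :: "equation \<Rightarrow> equation \<Rightarrow> bool" where
  "mid_laplace e e' \<longleftrightarrow> (\<exists>\<alpha>s Tb Bs. induced_data e \<alpha>s Tb Bs \<and>
     e' = \<lparr> lead_mat = - Tb, sing_pts = \<alpha>s, res_mats = Bs \<rparr>)"

definition inv_mid_laplace :: "equation \<Rightarrow> equation \<Rightarrow> bool" where
  "inv_mid_laplace e e' \<longleftrightarrow> (\<exists>\<alpha>s Tb Bs. induced_data e \<alpha>s Tb Bs \<and>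
     e' = \<lparr> lead_mat = Tb, sing_pts = map uminus \<alpha>s, res_mats = Bs \<rparr>)"

end

theory Submission
  imports Defs
begin

text \<open>Write the coefficient matrix as \<open>S + Q (x - T)\<^sup>-\<^sup>1 P\<close> with \<open>T\<close> the operator induced on
  \<open>(\<complex>\<^sup>N)\<^sup>q / K\<close>, where \<open>P\<close> is induced by the diagonal embedding and \<open>Q\<close> by
  \<open>(v\<^sub>k) \<mapsto> \<Sum>\<^sub>k A\<^sub>k v\<^sub>k\<close>.  This factorization is minimal: \<open>Q\<close> is injective on the
  eigenspaces of \<open>T\<close>, and \<open>P\<close> followed by a spectral projection of \<open>T\<close> is surjective onto the
  eigenspace.  The middle Laplace transform is \<open>-T - P (x - S)\<^sup>-\<^sup>1 Q\<close>, so up to signs it swaps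
  \<open>(S, Q)\<close> with \<open>(T, P)\<close>.  Irreducibility and non-exceptionality say exactly enough to make the
  swapped factorization minimal as well; since minimal factorizations with given \<open>S\<close> are unique up
  to conjugation, transforming back returns the original equation up to a constant gauge.\<close>

section \<open>Linear maps between coordinate spaces\<close>

text \<open>Irreducibility enters the duality through invariant subspaces. An eigenvector of
  \<open>S\<close> killed by all residues spans an invariant line, which is the whole space only for
  an exceptional equation; hence \<open>P\<close> is injective on the eigenspaces of
  \<open>S\<close>. The vectors whose \<alpha>-component lies in the \<alpha>-component of the range
  of \<open>Q\<close> form another invariant subspace; hence \<open>Q\<close> followed by a spectral
  projection of \<open>S\<close> is onto the eigenspace. These are the two minimality conditions
  with \<open>S\<close> and \<open>T\<close> exchanged. Two obstacles shape the statements. The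
  matrices of a transform refer to an arbitrary basis of the quotient, so arbitrary minimal
  factorizations have to be compared. And a residue may be zero: its singular point is then no
  eigenvalue of \<open>T\<close> and is lost in the double transform. Spectral projections are
  therefore indexed by all singular points and may vanish, and the original and the final equation
  are matched pole by pole up to zero terms. A sign \<open>s\<close>, equal to 1 or -1, treats both
  transforms at once; the original \<open>S\<close> comes back because
  \<open>s * s = 1\<close>.\<close>

definition vsubspace :: "nat \<Rightarrow> complex vec set \<Rightarrow> bool" where
  "vsubspace n W \<longleftrightarrow> W \<subseteq> carrier_vec n \<and> 0\<^sub>v n \<in> W \<and>
     (\<forall>u\<in>W. \<forall>v\<in>W. u + v \<in> W) \<and> (\<forall>c. \<forall>v\<in>W. c \<cdot>\<^sub>v v \<in> W)"

lemma vsubspaceI: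
  assumes "W \<subseteq> carrier_vec n" "0\<^sub>v n \<in> W" "\<And>u v. u \<in> W \<Longrightarrow> v \<in> W \<Longrightarrow> u + v \<in> W"
    "\<And>c v. v \<in> W \<Longrightarrow> c \<cdot>\<^sub>v v \<in> W"
  shows "vsubspace n W"
  using assms unfolding vsubspace_def by auto

lemma vsubspaceD:
  assumes "vsubspace n W"
  shows "\<And>v. v \<in> W \<Longrightarrow> v \<in> carrier_vec n" "0\<^sub>v n \<in> W" "\<And>u v. u \<in> W \<Longrightarrow> v \<in> W \<Longrightarrow> u + v \<in> W"
    "\<And>c v. v \<in> W \<Longrightarrow> c \<cdot>\<^sub>v v \<in> W"
  using assms unfolding vsubspace_def by auto

lemma vsubspace_diff:
  assumes W: "vsubspace n W" and "u \<in> W" "v \<in> W"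
  shows "u - v \<in> W"
proof -
  have "u - v = u + (-1) \<cdot>\<^sub>v v"
    using vsubspaceD(1)[OF W] assms(2,3) by (intro eq_vecI) auto
  then show ?thesis using vsubspaceD[OF W] assms(2,3) by simp
qed

lemma subspace_module_vec_iff:
  "VectorSpace.subspace class_ring W (module_vec TYPE(complex) n) \<longleftrightarrow> vsubspace n W"
proof
  assume "VectorSpace.subspace class_ring W (module_vec TYPE(complex) n)"
  then have "submodule class_ring W (module_vec TYPE(complex) n)"
    by (simp add: VectorSpace.subspace_def)
  then show "vsubspace n W"
    by (auto simp: LinearCombinations.submodule_def vsubspace_def module_vec_simps class_ring_simps)
next
  assume "vsubspace n W"
  then show "VectorSpace.subspace class_ring W (module_vec TYPE(complex) n)"
    unfolding VectorSpace.subspace_def LinearCombinations.submodule_def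
    using vec_vs[of n] vec_module[of n]
    by (simp add: vsubspace_def module_vec_simps class_ring_simps)
qed

section \<open>Linear maps and their matrices\<close>

definition vlinear :: "nat \<Rightarrow> nat \<Rightarrow> (complex vec \<Rightarrow> complex vec) \<Rightarrow> bool" where
  "vlinear n m f \<longleftrightarrow> (\<forall>v\<in>carrier_vec n. f v \<in> carrier_vec m) \<and>
     (\<forall>u\<in>carrier_vec n. \<forall>v\<in>carrier_vec n. f (u + v) = f u + f v) \<and>
     (\<forall>c. \<forall>v\<in>carrier_vec n. f (c \<cdot>\<^sub>v v) = c \<cdot>\<^sub>v f v)"

lemma vlinearI:
  assumes "\<And>v. v \<in> carrier_vec n \<Longrightarrow> f v \<in> carrier_vec m"
    "\<And>u v. u \<in> carrier_vec n \<Longrightarrow> v \<in> carrier_vec n \<Longrightarrow> f (u + v) = f u + f v"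
    "\<And>c v. v \<in> carrier_vec n \<Longrightarrow> f (c \<cdot>\<^sub>v v) = c \<cdot>\<^sub>v f v"
  shows "vlinear n m f"
  using assms unfolding vlinear_def by auto

lemma vlinearD:
  assumes "vlinear n m f"
  shows "\<And>v. v \<in> carrier_vec n \<Longrightarrow> f v \<in> carrier_vec m"
    "\<And>u v. u \<in> carrier_vec n \<Longrightarrow> v \<in> carrier_vec n \<Longrightarrow> f (u + v) = f u + f v"
    "\<And>c v. v \<in> carrier_vec n \<Longrightarrow> f (c \<cdot>\<^sub>v v) = c \<cdot>\<^sub>v f v"
  using assms unfolding vlinear_def by auto

lemma vlinear_zero:
  assumes "vlinear n m f"
  shows "f (0\<^sub>v n) = 0\<^sub>v m"
proof -
  have "0\<^sub>v n = 0 \<cdot>\<^sub>v (0\<^sub>v n :: complex vec)" by (intro eq_vecI) auto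
  then have "f (0\<^sub>v n) = 0 \<cdot>\<^sub>v f (0\<^sub>v n)" using vlinearD(3)[OF assms, of "0\<^sub>v n" 0] by simp
  also have "\<dots> = 0\<^sub>v m" using vlinearD(1)[OF assms, of "0\<^sub>v n"] by (intro eq_vecI) auto
  finally show ?thesis .
qed

lemma vlinear_diff:
  assumes f: "vlinear n m f" and "u \<in> carrier_vec n" "v \<in> carrier_vec n"
  shows "f (u - v) = f u - f v"
proof -
  have "u - v = u + (-1) \<cdot>\<^sub>v v" using assms(2,3) by (intro eq_vecI) auto
  then have "f (u - v) = f u + (-1) \<cdot>\<^sub>v f v" using vlinearD[OF f] assms(2,3) by simp
  also have "\<dots> = f u - f v"
    using vlinearD(1)[OF f] assms(2,3) by (intro eq_vecI) (auto dest!: carrier_vecD)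
  finally show ?thesis .
qed

lemma vlinear_mat: "A \<in> carrier_mat m n \<Longrightarrow> vlinear n m ((*\<^sub>v) A)"
  by (rule vlinearI) (auto simp: mult_add_distrib_mat_vec mult_mat_vec)

lemma vlinear_comp: "vlinear n m f \<Longrightarrow> vlinear m k g \<Longrightarrow> vlinear n k (\<lambda>v. g (f v))"
  by (rule vlinearI) (simp_all add: vlinearD)

lemma mat_mult_unit_vec:
  fixes A :: "complex mat"
  assumes "A \<in> carrier_mat m n" "j < n"
  shows "A *\<^sub>v unit_vec n j = col A j"
  using assms by (intro eq_vecI) auto

lemma mat_eq_vecI:
  fixes A B :: "complex mat"
  assumes A: "A \<in> carrier_mat m n" and B: "B \<in> carrier_mat m n"
    and eq: "\<And>v. v \<in> carrier_vec n \<Longrightarrow> A *\<^sub>v v = B *\<^sub>v v"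
  shows "A = B"
proof (rule mat_col_eqI)
  fix j assume "j < dim_col B"
  then show "col A j = col B j"
    using mat_mult_unit_vec[OF A, of j] mat_mult_unit_vec[OF B, of j] eq[of "unit_vec n j"] B
    by auto
qed (use A B in auto)

definition mat_of_fun :: "nat \<Rightarrow> nat \<Rightarrow> (complex vec \<Rightarrow> complex vec) \<Rightarrow> complex mat" where
  "mat_of_fun n m f = mat m n (\<lambda>(i, j). f (unit_vec n j) $ i)"

lemma mat_of_fun_carrier [simp]: "mat_of_fun n m f \<in> carrier_mat m n"
  by (simp add: mat_of_fun_def)

lemma col_mat_of_fun:
  assumes "vlinear n m f" "j < n"
  shows "col (mat_of_fun n m f) j = f (unit_vec n j)"
  using assms(2) vlinearD(1)[OF assms(1), of "unit_vec n j"]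
  by (intro eq_vecI) (auto simp: mat_of_fun_def)

lemma mat_of_fun_mult:
  assumes f: "vlinear n m f" and v: "v \<in> carrier_vec n"
  shows "mat_of_fun n m f *\<^sub>v v = f v"
proof -
  \<comment> \<open>The truncation of \<open>v\<close> to its first \<open>k\<close> coordinates:
    each induction step adds one multiple of a unit vector, and \<open>t n\<close> is
    \<open>v\<close>.\<close>
  define t where "t k = vec n (\<lambda>i. if i < k then v $ i else 0)" for k
  have t: "t k \<in> carrier_vec n" for k by (simp add: t_def)
  note G = vlinear_mat[OF mat_of_fun_carrier[of n m f]]
  have "k \<le> n \<Longrightarrow> mat_of_fun n m f *\<^sub>v t k = f (t k)" for k
  proof (induction k)
    case 0
    have "t 0 = 0\<^sub>v n" by (intro eq_vecI) (auto simp: t_def)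
    then show ?case using vlinear_zero[OF f] vlinear_zero[OF G] by simp
  next
    case (Suc k)
    have s: "t (Suc k) = t k + v $ k \<cdot>\<^sub>v unit_vec n k"
      using Suc.prems by (intro eq_vecI) (auto simp: t_def less_Suc_eq)
    show ?case
      unfolding s using Suc t mat_mult_unit_vec[OF mat_of_fun_carrier[of n m f], of k]
      by (simp add: vlinearD(2)[OF f] vlinearD(2)[OF G] vlinearD(3)[OF f] vlinearD(3)[OF G]
          col_mat_of_fun[OF f])
  qed
  moreover have "t n = v" using v by (intro eq_vecI) (auto simp: t_def)
  ultimately show ?thesis by fastforce
qed

text \<open>The traces of \<open>G H\<close> and \<open>H G\<close> agree.\<close>

lemma inverse_mats_square:
  fixes G H :: "complex mat"
  assumes G: "G \<in> carrier_mat m n" and H: "H \<in> carrier_mat n m"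
    and GH: "\<And>v. v \<in> carrier_vec m \<Longrightarrow> G *\<^sub>v (H *\<^sub>v v) = v"
    and HG: "\<And>v. v \<in> carrier_vec n \<Longrightarrow> H *\<^sub>v (G *\<^sub>v v) = v"
  shows "m = n" "G * H = 1\<^sub>m m" "H * G = 1\<^sub>m n"
proof -
  show 1: "G * H = 1\<^sub>m m" using G H GH by (intro mat_eq_vecI[of _ m m]) auto
  show 2: "H * G = 1\<^sub>m n" using G H HG by (intro mat_eq_vecI[of _ n n]) auto
  have "(of_nat m :: complex) = (\<Sum>i<m. (G * H) $$ (i, i))" by (simp add: 1)
  also have "\<dots> = (\<Sum>i<m. \<Sum>j<n. G $$ (i, j) * H $$ (j, i))"
    using G H by (intro sum.cong) (auto simp: scalar_prod_def lessThan_atLeast0)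
  also have "\<dots> = (\<Sum>j<n. \<Sum>i<m. G $$ (i, j) * H $$ (j, i))" by (rule sum.swap)
  also have "\<dots> = (\<Sum>j<n. (H * G) $$ (j, j))"
    using G H by (intro sum.cong) (auto simp: scalar_prod_def lessThan_atLeast0 mult.commute)
  also have "\<dots> = of_nat n" by (simp add: 2)
  finally show "m = n" by simp
qed

section \<open>Finite sums of vectors\<close>

definition vsum :: "nat \<Rightarrow> ('i \<Rightarrow> complex vec) \<Rightarrow> 'i set \<Rightarrow> complex vec" where
  "vsum n f I = vec n (\<lambda>r. \<Sum>i\<in>I. f i $ r)"

lemma vsum_carrier [simp]: "vsum n f I \<in> carrier_vec n"
  by (simp add: vsum_def)

lemma vsum_cong: "(\<And>i. i \<in> I \<Longrightarrow> f i = g i) \<Longrightarrow> vsum n f I = vsum n g I"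
  by (simp add: vsum_def)

lemma vsum_empty: "vsum n f {} = 0\<^sub>v n"
  by (intro eq_vecI) (auto simp: vsum_def)

lemma vsum_insert:
  assumes "finite I" "i \<notin> I" "f i \<in> carrier_vec n"
  shows "vsum n f (insert i I) = f i + vsum n f I"
  using assms by (intro eq_vecI) (auto simp: vsum_def)

lemma vsum_add:
  assumes "\<And>i. i \<in> I \<Longrightarrow> g i \<in> carrier_vec n" 
  shows "vsum n (\<lambda>i. f i + g i) I = vsum n f I + vsum n g I"
proof (intro eq_vecI)
  fix r assume "r < dim_vec (vsum n f I + vsum n g I)"
  then have r: "r < n" by (simp add: vsum_def)
  have "(\<Sum>i\<in>I. (f i + g i) $ r) = (\<Sum>i\<in>I. f i $ r + g i $ r)"
    using r carrier_vecD[OF assms] by (intro sum.cong) auto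
  then show "vsum n (\<lambda>i. f i + g i) I $ r = (vsum n f I + vsum n g I) $ r"
    using r by (simp add: vsum_def sum.distrib)
qed (simp add: vsum_def)

lemma vsum_smult:
  assumes "\<And>i. i \<in> I \<Longrightarrow> f i \<in> carrier_vec n" 
  shows "vsum n (\<lambda>i. c \<cdot>\<^sub>v f i) I = c \<cdot>\<^sub>v vsum n f I"
proof (intro eq_vecI)
  fix r assume "r < dim_vec (c \<cdot>\<^sub>v vsum n f I)"
  then have r: "r < n" by (simp add: vsum_def)
  have "(\<Sum>i\<in>I. (c \<cdot>\<^sub>v f i) $ r) = (\<Sum>i\<in>I. c * f i $ r)"
    using r carrier_vecD[OF assms] by (intro sum.cong) auto
  then show "vsum n (\<lambda>i. c \<cdot>\<^sub>v f i) I $ r = (c \<cdot>\<^sub>v vsum n f I) $ r"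
    using r by (simp add: vsum_def sum_distrib_left)
qed (simp add: vsum_def)

lemma vsum_in_subspace:
  assumes "vsubspace n W" "\<And>i. i \<in> I \<Longrightarrow> f i \<in> W"
  shows "vsum n f I \<in> W"
proof (cases "finite I")
  case True
  then show ?thesis using assms(2)
  proof induction
    case empty
    then show ?case using vsubspaceD(2)[OF assms(1)] by (simp add: vsum_empty)
  next
    case (insert i I)
    then show ?case using vsubspaceD[OF assms(1)] by (simp add: vsum_insert)
  qed
next
  case False
  then have "vsum n f I = 0\<^sub>v n" by (intro eq_vecI) (auto simp: vsum_def)
  then show ?thesis using vsubspaceD(2)[OF assms(1)] by simp
qed

lemma vlinear_vsum:
  assumes f: "vlinear n m f" and I: "finite I" and "\<And>i. i \<in> I \<Longrightarrow> g i \<in> carrier_vec n"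
  shows "f (vsum n g I) = vsum m (\<lambda>i. f (g i)) I"
  using I assms(3)
proof induction
  case empty
  then show ?case using vlinear_zero[OF f] by (simp add: vsum_empty)
next
  case (insert i I)
  then show ?case by (simp add: vsum_insert vlinearD[OF f])
qed

lemma vsum_single:
  assumes "finite I" "j \<in> I" "f j \<in> carrier_vec n"
    and "\<And>i. i \<in> I \<Longrightarrow> i \<noteq> j \<Longrightarrow> f i = 0\<^sub>v n"
  shows "vsum n f I = f j"
proof (rule eq_vecI)
  fix r assume r: "r < dim_vec (f j)"
  then have r: "r < n" using assms(3) by auto
  have "(\<Sum>i\<in>I. f i $ r) = (\<Sum>i\<in>I. if i = j then f j $ r else 0)"
    using assms(4) r by (intro sum.cong) auto
  then show "vsum n f I $ r = f j $ r" using r assms(1,2) by (simp add: vsum_def)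
qed (use assms(3) in \<open>auto simp: vsum_def\<close>)

text \<open>The sum \<open>vsum\<close> is formed by coordinates, so that it is a vector of length
  \<open>n\<close> without any condition on the summands. This lemma is the bridge to the library
  sum that occurs in \<open>B_op\<close>.\<close>

lemma finsum_vec_eq_vsum:
  assumes "finite I" "\<And>i. i \<in> I \<Longrightarrow> f i \<in> carrier_vec n"
  shows "finsum_vec TYPE(complex) n f I = vsum n f I"
  using assms
proof induction
  case empty
  then show ?case by (simp add: finsum_vec_empty vsum_empty)
next
  case (insert i I)
  then show ?case by (subst finsum_vec_insert) (auto simp: vsum_insert)
qed

section \<open>Bases modulo a subspace\<close>

lemma mat_of_cols_Cons_mult:
  assumes x: "(x :: complex vec) \<in> carrier_vec n" and bs: "set bs \<subseteq> carrier_vec n"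
    and c: "c \<in> carrier_vec (Suc (length bs))"
  shows "mat_of_cols n (x # bs) *\<^sub>v c =
    c $ 0 \<cdot>\<^sub>v x + mat_of_cols n bs *\<^sub>v vec (length bs) (\<lambda>i. c $ Suc i)"
proof (rule eq_vecI)
  fix i assume "i < dim_vec (c $ 0 \<cdot>\<^sub>v x + mat_of_cols n bs *\<^sub>v vec (length bs) (\<lambda>i. c $ Suc i))"
  then have i: "i < n" by simp
  have "(mat_of_cols n (x # bs) *\<^sub>v c) $ i = (\<Sum>j<Suc (length bs). (x # bs) ! j $ i * c $ j)"
    using i x bs c by (auto simp: scalar_prod_def mat_of_cols_def lessThan_atLeast0 intro!: sum.cong)
  also have "\<dots> = x $ i * c $ 0 + (\<Sum>j<length bs. bs ! j $ i * c $ Suc j)"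
    by (simp only: sum.lessThan_Suc_shift nth_Cons_0 nth_Cons_Suc)
  also have "\<dots> = (c $ 0 \<cdot>\<^sub>v x + mat_of_cols n bs *\<^sub>v vec (length bs) (\<lambda>i. c $ Suc i)) $ i"
    using i x bs by (auto simp: scalar_prod_def mat_of_cols_def lessThan_atLeast0 mult.commute)
  finally show "(mat_of_cols n (x # bs) *\<^sub>v c) $ i = 
    (c $ 0 \<cdot>\<^sub>v x + mat_of_cols n bs *\<^sub>v vec (length bs) (\<lambda>i. c $ Suc i)) $ i" .
qed (use x in auto)

text \<open>Greedy selection: a vector joins the list exactly when it is not yet a combination of
  the chosen ones modulo \<open>K\<close>. It serves twice: with \<open>K\<close> zero it extracts
  an eigenbasis, with the space \<open>K_space\<close> it yields a basis of the quotient. That the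
  basis consists of given vectors matters for the eigenbasis.\<close>

lemma basis_selection_mod_subspace:
  assumes K: "vsubspace n K" and xs: "set xs \<subseteq> carrier_vec n"
  shows "\<exists>bs. set bs \<subseteq> set xs \<and>
    (\<forall>c\<in>carrier_vec (length bs). mat_of_cols n bs *\<^sub>v c \<in> K \<longrightarrow> c = 0\<^sub>v (length bs)) \<and>
    (\<forall>x\<in>set xs. \<exists>c\<in>carrier_vec (length bs). x - mat_of_cols n bs *\<^sub>v c \<in> K)"
  using xs
proof (induction xs)
  case Nil
  then show ?case by (intro exI[of _ "[]"]) auto
next
  case (Cons x xs)
  then obtain bs where bs: "set bs \<subseteq> set xs"
    and inj: "\<And>c. c \<in> carrier_vec (length bs) \<Longrightarrow> mat_of_cols n bs *\<^sub>v c \<in> K \<Longrightarrow> c = 0\<^sub>v (length bs)"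
    and sp: "\<And>x. x \<in> set xs \<Longrightarrow> \<exists>c\<in>carrier_vec (length bs). x - mat_of_cols n bs *\<^sub>v c \<in> K"
    by auto
  have x: "x \<in> carrier_vec n" and xs: "set xs \<subseteq> carrier_vec n" using Cons.prems by auto
  let ?B = "mat_of_cols n bs"
  have B: "?B \<in> carrier_mat n (length bs)" by simp
  show ?case
  proof (cases "\<exists>c\<in>carrier_vec (length bs). x - ?B *\<^sub>v c \<in> K")
    case True
    then show ?thesis using bs inj sp by (intro exI[of _ bs]) auto
  next
    case False
    note mult = mat_of_cols_Cons_mult[OF x subset_trans[OF bs xs]]
    show ?thesis
    proof (intro exI[of _ "x # bs"] conjI ballI impI)
      show "set (x # bs) \<subseteq> set (x # xs)" using bs by auto
    next
      fix c assume c: "c \<in> carrier_vec (length (x # bs))" and cK: "mat_of_cols n (x # bs) *\<^sub>v c \<in> K"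
      define d where "d = vec (length bs) (\<lambda>i. c $ Suc i)"
      have d: "d \<in> carrier_vec (length bs)" by (simp add: d_def)
      have K1: "c $ 0 \<cdot>\<^sub>v x + ?B *\<^sub>v d \<in> K" using cK mult c by (simp add: d_def)
      \<comment> \<open>A nonzero leading coefficient could be divided out and would exhibit
        \<open>x\<close> as a combination of \<open>bs\<close> modulo \<open>K\<close>, against the
        case assumption.\<close>
      have c0: "c $ 0 = 0"
      proof (rule ccontr)
        assume nz: "c $ 0 \<noteq> 0"
        have "(1 / c $ 0) \<cdot>\<^sub>v (c $ 0 \<cdot>\<^sub>v x + ?B *\<^sub>v d) = x - ?B *\<^sub>v ((- 1 / c $ 0) \<cdot>\<^sub>v d)"
          unfolding mult_mat_vec[OF B d]
          using nz x B d by (intro eq_vecI) (auto simp: field_simps)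
        then have "x - ?B *\<^sub>v ((- 1 / c $ 0) \<cdot>\<^sub>v d) \<in> K" using vsubspaceD(4)[OF K K1] by metis
        then show False using False d by auto
      qed
      have "c $ 0 \<cdot>\<^sub>v x + ?B *\<^sub>v d = ?B *\<^sub>v d" using c0 x B by (intro eq_vecI) auto
      then have "d = 0\<^sub>v (length bs)" using inj[OF d] K1 by simp
      then have "c $ Suc i = 0" if "i < length bs" for i
        using that unfolding d_def by (metis index_vec index_zero_vec(1))
      then show "c = 0\<^sub>v (length (x # bs))"
        using c c0 by (intro eq_vecI) (auto simp: less_Suc_eq_0_disj)
    next
      fix y assume y: "y \<in> set (x # xs)"
      show "\<exists>c\<in>carrier_vec (length (x # bs)). y - mat_of_cols n (x # bs) *\<^sub>v c \<in> K"
      proof (cases "y \<in> set xs")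
        case True
        then obtain d where d: "d \<in> carrier_vec (length bs)" "y - ?B *\<^sub>v d \<in> K" using sp by blast
        let ?c = "vCons 0 d"
        have "vec (length bs) (\<lambda>i. ?c $ Suc i) = d" using d(1) by (intro eq_vecI) auto
        moreover have "0 \<cdot>\<^sub>v x + ?B *\<^sub>v d = ?B *\<^sub>v d" using x B by (intro eq_vecI) auto
        ultimately have "mat_of_cols n (x # bs) *\<^sub>v ?c = ?B *\<^sub>v d" using mult[of ?c] d(1) by simp
        then show ?thesis using d by (intro bexI[of _ ?c]) auto
      next
        case False
        then have [simp]: "y = x" using y by simp
        let ?c = "vCons 1 (0\<^sub>v (length bs))"
        have z: "vec (length bs) (\<lambda>i. ?c $ Suc i) = 0\<^sub>v (length bs)" by (intro eq_vecI) auto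
        have "mat_of_cols n (x # bs) *\<^sub>v ?c = 1 \<cdot>\<^sub>v x + ?B *\<^sub>v 0\<^sub>v (length bs)"
          using mult[of ?c] unfolding z by simp
        moreover have "y - (1 \<cdot>\<^sub>v x + ?B *\<^sub>v 0\<^sub>v (length bs)) = 0\<^sub>v n"
          using x B by (intro eq_vecI) auto
        ultimately show ?thesis using vsubspaceD(2)[OF K] by (intro bexI[of _ ?c]) auto
      qed
    qed
  qed
qed

section \<open>Spectral resolutions\<close>

text \<open>A relation that is linear, total and single-valued is the graph of a linear map. The
  matrices needed later are all characterized by such relations: the inverse of an eigenbasis, the
  map between two factorizations, and the coordinates modulo \<open>K_space\<close>.\<close>

lemma functional_relation_mat:
  assumes ex: "\<And>v. v \<in> carrier_vec n \<Longrightarrow> \<exists>c\<in>carrier_vec m. R v c"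
    and un: "\<And>v c d. v \<in> carrier_vec n \<Longrightarrow> c \<in> carrier_vec m \<Longrightarrow> d \<in> carrier_vec m \<Longrightarrow>
      R v c \<Longrightarrow> R v d \<Longrightarrow> c = d"
    and add: "\<And>u v c d. u \<in> carrier_vec n \<Longrightarrow> v \<in> carrier_vec n \<Longrightarrow> c \<in> carrier_vec m \<Longrightarrow>
      d \<in> carrier_vec m \<Longrightarrow> R u c \<Longrightarrow> R v d \<Longrightarrow> R (u + v) (c + d)"
    and smult: "\<And>k v c. v \<in> carrier_vec n \<Longrightarrow> c \<in> carrier_vec m \<Longrightarrow> R v c \<Longrightarrow> R (k \<cdot>\<^sub>v v) (k \<cdot>\<^sub>v c)"
  shows "\<exists>G::complex mat. G \<in> carrier_mat m n \<and>
    (\<forall>v\<in>carrier_vec n. \<forall>c\<in>carrier_vec m. R v c \<longleftrightarrow> c = G *\<^sub>v v)"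
proof -
  define f where "f v = (SOME c. c \<in> carrier_vec m \<and> R v c)" for v
  have f: "f v \<in> carrier_vec m \<and> R v (f v)" if "v \<in> carrier_vec n" for v
    unfolding f_def by (rule someI_ex) (use ex[OF that] in blast)
  have f_eq: "f v = c" if "v \<in> carrier_vec n" "c \<in> carrier_vec m" "R v c" for v c
    using f un that by blast
  have lin: "vlinear n m f"
    by (rule vlinearI) (auto simp: f intro!: f_eq add smult)
  have "R v c \<longleftrightarrow> c = mat_of_fun n m f *\<^sub>v v"
    if "v \<in> carrier_vec n" "c \<in> carrier_vec m" for v c
    using f f_eq that by (auto simp: mat_of_fun_mult[OF lin])
  then show ?thesis by (intro exI[of _ "mat_of_fun n m f"]) simp
qed

lemma smult_mat_mult_vec:
  "A \<in> carrier_mat m n \<Longrightarrow> v \<in> carrier_vec n \<Longrightarrow> (c \<cdot>\<^sub>m A) *\<^sub>v v = c \<cdot>\<^sub>v (A *\<^sub>v v :: complex vec)"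
  by (intro eq_vecI) auto

lemma zero_smult_vec: "(v :: complex vec) \<in> carrier_vec n \<Longrightarrow> 0 \<cdot>\<^sub>v v = 0\<^sub>v n"
  by (intro eq_vecI) auto

lemma smult_zero_vec_carrier: "c \<cdot>\<^sub>v (0\<^sub>v n :: complex vec) = 0\<^sub>v n"
  by (intro eq_vecI) auto

lemma diff_eq_zero_vec_iff:
  fixes u v :: "complex vec"
  assumes "u \<in> carrier_vec n" "v \<in> carrier_vec n"
  shows "u - v = 0\<^sub>v n \<longleftrightarrow> u = v"
proof
  assume uv: "u - v = 0\<^sub>v n"
  show "u = v"
  proof (rule eq_vecI)
    fix r assume "r < dim_vec v"
    then show "u $ r = v $ r" using arg_cong[OF uv, of "\<lambda>x. x $ r"] assms by simp
  qed (use assms in simp)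
qed (use assms in simp)

lemma smult_vec_eq_zero:
  fixes v :: "complex vec"
  assumes v: "v \<in> carrier_vec n" and eq: "c \<cdot>\<^sub>v v = d \<cdot>\<^sub>v v" and "c \<noteq> d"
  shows "v = 0\<^sub>v n"
proof (rule eq_vecI)
  fix r assume "r < dim_vec (0\<^sub>v n :: complex vec)"
  then show "v $ r = (0\<^sub>v n :: complex vec) $ r"
    using arg_cong[OF eq, of "\<lambda>x. x $ r"] v \<open>c \<noteq> d\<close> by simp
qed (use v in simp)

lemma unit_vecs_span:
  assumes "v \<in> carrier_vec n"
  shows "vsum n (\<lambda>j. v $ j \<cdot>\<^sub>v unit_vec n j) {..<n} = v"
proof (rule eq_vecI)
  fix r assume "r < dim_vec v"
  then have r: "r < n" using assms by auto
  have "(\<Sum>j<n. (v $ j \<cdot>\<^sub>v unit_vec n j) $ r) = (\<Sum>j<n. if j = r then v $ r else 0)"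
    using r by (intro sum.cong) auto
  then show "vsum n (\<lambda>j. v $ j \<cdot>\<^sub>v unit_vec n j) {..<n} $ r = v $ r"
    using r by (simp add: vsum_def)
qed (use assms in \<open>auto simp: vsum_def\<close>)

text \<open>The family may contain zero projections: \<open>a\<close> has to be injective, but its
  values need not be eigenvalues. This leaves room for singular points with zero residue. The
  conditions are stated on vectors because the projections are used only through their
  action.\<close>

locale spectral_resolution =
  fixes n :: nat and S :: "complex mat" and I :: "'i set" and a :: "'i \<Rightarrow> complex"
    and E :: "'i \<Rightarrow> complex mat"
  assumes finite_I: "finite I" and inj_a: "inj_on a I" and S_carrier: "S \<in> carrier_mat n n"
    and E_carrier: "i \<in> I \<Longrightarrow> E i \<in> carrier_mat n n"
    and sum_E: "v \<in> carrier_vec n \<Longrightarrow> vsum n (\<lambda>i. E i *\<^sub>v v) I = v"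
    and S_E: "i \<in> I \<Longrightarrow> v \<in> carrier_vec n \<Longrightarrow> S *\<^sub>v (E i *\<^sub>v v) = a i \<cdot>\<^sub>v (E i *\<^sub>v v)"
    and E_E: "i \<in> I \<Longrightarrow> j \<in> I \<Longrightarrow> v \<in> carrier_vec n \<Longrightarrow>
      E i *\<^sub>v (E j *\<^sub>v v) = (if i = j then E i *\<^sub>v v else 0\<^sub>v n)"
begin

lemma E_vec [simp]: "i \<in> I \<Longrightarrow> v \<in> carrier_vec n \<Longrightarrow> E i *\<^sub>v v \<in> carrier_vec n"
  using mult_mat_vec_carrier[OF E_carrier] .

lemma S_vec [simp]: "v \<in> carrier_vec n \<Longrightarrow> S *\<^sub>v v \<in> carrier_vec n"
  using mult_mat_vec_carrier[OF S_carrier] .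

lemmas lin_E = vlinear_mat[OF E_carrier]
lemmas lin_S = vlinear_mat[OF S_carrier]

lemma E_S:
  assumes i: "i \<in> I" and v: "v \<in> carrier_vec n"
  shows "E i *\<^sub>v (S *\<^sub>v v) = a i \<cdot>\<^sub>v (E i *\<^sub>v v)"
proof -
  have "S *\<^sub>v v = S *\<^sub>v vsum n (\<lambda>j. E j *\<^sub>v v) I" by (simp add: sum_E v)
  also have "\<dots> = vsum n (\<lambda>j. S *\<^sub>v (E j *\<^sub>v v)) I"
    using v by (intro vlinear_vsum[OF lin_S finite_I]) simp
  also have "E i *\<^sub>v \<dots> = vsum n (\<lambda>j. E i *\<^sub>v (S *\<^sub>v (E j *\<^sub>v v))) I"
    using v i by (intro vlinear_vsum[OF lin_E finite_I]) simp_all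
  also have "\<dots> = vsum n (\<lambda>j. a j \<cdot>\<^sub>v (if i = j then E i *\<^sub>v v else 0\<^sub>v n)) I"
    using v i by (intro vsum_cong) (auto simp: S_E E_E vlinearD(3)[OF lin_E] simp del: if_split)
  also have "\<dots> = a i \<cdot>\<^sub>v (E i *\<^sub>v v)"
    using v i finite_I by (subst vsum_single[where j = i]) auto
  finally show ?thesis .
qed

text \<open>Applying \<open>E j\<close> to the eigenvalue equation gives \<open>a j\<close> and
  \<alpha> as factors of the same component, so all components with another label vanish. What
  remains of the sum of components is the single one with label \<alpha>.\<close>

lemma E_eigenvector:
  assumes v: "v \<in> carrier_vec n" and eig: "S *\<^sub>v v = \<alpha> \<cdot>\<^sub>v v" and i: "i \<in> I"
  shows "a i \<noteq> \<alpha> \<Longrightarrow> E i *\<^sub>v v = 0\<^sub>v n" and "a i = \<alpha> \<Longrightarrow> E i *\<^sub>v v = v"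
proof -
  have 0: "E j *\<^sub>v v = 0\<^sub>v n" if j: "j \<in> I" "a j \<noteq> \<alpha>" for j
  proof -
    have eq: "a j \<cdot>\<^sub>v (E j *\<^sub>v v) = \<alpha> \<cdot>\<^sub>v (E j *\<^sub>v v)"
      using E_S[OF j(1) v] eig vlinearD(3)[OF lin_E[OF j(1)] v] by simp
    show ?thesis using smult_vec_eq_zero[OF E_vec[OF j(1) v] eq j(2)] .
  qed
  show "a i \<noteq> \<alpha> \<Longrightarrow> E i *\<^sub>v v = 0\<^sub>v n" using 0[OF i] .
  show "E i *\<^sub>v v = v" if "a i = \<alpha>"
  proof -
    have "a j \<noteq> \<alpha>" if "j \<in> I" "j \<noteq> i" for j using inj_a that i \<open>a i = \<alpha>\<close> by (auto dest: inj_onD)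
    then have "vsum n (\<lambda>j. E j *\<^sub>v v) I = E i *\<^sub>v v"
      using 0 i v finite_I by (intro vsum_single) auto
    then show ?thesis using sum_E[OF v] by simp
  qed
qed

text \<open>For a label outside the family every component of an eigenvector would vanish, and so
  would their sum. Only one inclusion can hold, since the projections may be zero.\<close>

lemma eigenvalue_in:
  assumes "eigenvalue S \<alpha>"
  shows "\<alpha> \<in> a ` I"
proof (rule ccontr)
  assume n: "\<alpha> \<notin> a ` I"
  obtain v where v: "v \<in> carrier_vec n" "v \<noteq> 0\<^sub>v n" "S *\<^sub>v v = \<alpha> \<cdot>\<^sub>v v"
    using assms S_carrier unfolding eigenvalue_def eigenvector_def by auto
  have "vsum n (\<lambda>i. E i *\<^sub>v v) I = vsum n (\<lambda>i. 0\<^sub>v n) I"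
    using E_eigenvector(1)[OF v(1,3)] n by (intro vsum_cong) auto
  also have "\<dots> = 0\<^sub>v n" by (intro eq_vecI) (auto simp: vsum_def)
  finally show False using sum_E[OF v(1)] v(2) by simp
qed

text \<open>Two matrices with the defining property agree on every component
  \<open>E j *\<^sub>v v\<close>, and these add up to \<open>v\<close>. The point is that the
  definite description in \<open>eigenproj\<close> can be evaluated by any resolution, in particular
  by one built by hand on the quotient.\<close>

lemma eigenproj_eq:
  assumes i: "i \<in> I"
  shows "eigenproj S (a i) = E i"
proof -
  have dim [simp]: "dim_row S = n" using S_carrier by simp
  show ?thesis unfolding eigenproj_def dim
  proof (rule the_equality)
    show "E i \<in> carrier_mat n n \<and> (\<forall>v\<in>carrier_vec n. S *\<^sub>v v = a i \<cdot>\<^sub>v v \<longrightarrow> E i *\<^sub>v v = v) \<and>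
      (\<forall>\<beta>. \<beta> \<noteq> a i \<longrightarrow> (\<forall>v\<in>carrier_vec n. S *\<^sub>v v = \<beta> \<cdot>\<^sub>v v \<longrightarrow> E i *\<^sub>v v = 0\<^sub>v n))"
      using i E_carrier E_eigenvector[OF _ _ i] by metis
  next
    fix F assume F: "F \<in> carrier_mat n n \<and> (\<forall>v\<in>carrier_vec n. S *\<^sub>v v = a i \<cdot>\<^sub>v v \<longrightarrow> F *\<^sub>v v = v) \<and>
      (\<forall>\<beta>. \<beta> \<noteq> a i \<longrightarrow> (\<forall>v\<in>carrier_vec n. S *\<^sub>v v = \<beta> \<cdot>\<^sub>v v \<longrightarrow> F *\<^sub>v v = 0\<^sub>v n))"
    show "F = E i"
    proof (rule mat_eq_vecI[of _ n n])
      fix v assume v: "(v :: complex vec) \<in> carrier_vec n"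
      have FE: "F *\<^sub>v (E j *\<^sub>v v) = (if j = i then E i *\<^sub>v v else 0\<^sub>v n)" if j: "j \<in> I" for j
        using F S_E[OF j v] E_vec[OF j v] inj_onD[OF inj_a _ j i] by auto
      have "F *\<^sub>v v = F *\<^sub>v vsum n (\<lambda>j. E j *\<^sub>v v) I" by (simp add: sum_E v)
      also have "\<dots> = vsum n (\<lambda>j. F *\<^sub>v (E j *\<^sub>v v)) I"
        using v F by (intro vlinear_vsum[OF vlinear_mat finite_I]) auto
      also have "\<dots> = F *\<^sub>v (E i *\<^sub>v v)"
        using FE i v finite_I by (intro vsum_single) auto
      finally show "F *\<^sub>v v = E i *\<^sub>v v" using FE[OF i] by simp
    qed (use F E_carrier i in auto)
  qed
qed

text \<open>Each projection is a polynomial in \<open>S\<close>, namely the Lagrange polynomial with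
  factors \<open>(S - a j) / (a k - a j)\<close> for \<open>j\<close> different from
  \<open>k\<close>. The induction applies one factor at a time and records which components have
  been removed.\<close>

lemma E_invariant_subspace:
  assumes U: "vsubspace n U" and inv: "\<And>u. u \<in> U \<Longrightarrow> S *\<^sub>v u \<in> U" and u: "u \<in> U" and k: "k \<in> I"
  shows "E k *\<^sub>v u \<in> U"
proof -
  have "\<exists>w\<in>U. E k *\<^sub>v w = E k *\<^sub>v u \<and> (\<forall>j\<in>J. E j *\<^sub>v w = 0\<^sub>v n)" if "J \<subseteq> I - {k}" for J
    using finite_subset[OF that finite_Diff[OF finite_I]] that
  proof (induction J)
    case empty
    then show ?case using u by auto
  next
    case (insert j J)
    then obtain w where w: "w \<in> U" "E k *\<^sub>v w = E k *\<^sub>v u" "\<forall>j\<in>J. E j *\<^sub>v w = 0\<^sub>v n" by auto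
    have wn: "w \<in> carrier_vec n" using vsubspaceD(1)[OF U w(1)] .
    have j: "j \<in> I" "j \<noteq> k" using insert.prems by auto
    then have ajk: "a k \<noteq> a j" using inj_a k by (auto dest: inj_onD)
    \<comment> \<open>One Lagrange factor: it multiplies component \<open>i\<close> by
      \<open>(a i - a j) / (a k - a j)\<close>, hence fixes component \<open>k\<close>, kills
      component \<open>j\<close> and keeps the components already removed at zero.\<close>
    define w' where "w' = (1 / (a k - a j)) \<cdot>\<^sub>v (S *\<^sub>v w - a j \<cdot>\<^sub>v w)"
    have "w' \<in> U" unfolding w'_def
      using vsubspaceD(4)[OF U] vsubspace_diff[OF U] inv w(1) by blast
    moreover have Ew': "E i *\<^sub>v w' = ((a i - a j) / (a k - a j)) \<cdot>\<^sub>v (E i *\<^sub>v w)" if i: "i \<in> I" for i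
    proof -
      have "E i *\<^sub>v w' = (1 / (a k - a j)) \<cdot>\<^sub>v (a i \<cdot>\<^sub>v (E i *\<^sub>v w) - a j \<cdot>\<^sub>v (E i *\<^sub>v w))"
        unfolding w'_def using wn i
        by (simp add: vlinearD(3)[OF lin_E] vlinear_diff[OF lin_E] E_S)
      also have "\<dots> = ((a i - a j) / (a k - a j)) \<cdot>\<^sub>v (E i *\<^sub>v w)"
        by (intro eq_vecI) (auto simp: field_simps simp del: index_mult_mat_vec)
      finally show ?thesis .
    qed
    have "E k *\<^sub>v w' = E k *\<^sub>v u" using Ew'[OF k] w(2) ajk by simp
    moreover have "E l *\<^sub>v w' = 0\<^sub>v n" if "l \<in> insert j J" for l
    proof (cases "l = j")
      case True
      then have "E l *\<^sub>v w' = 0 \<cdot>\<^sub>v (E j *\<^sub>v w)" using Ew'[OF j(1)] by simp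
      also have "\<dots> = 0\<^sub>v n" using zero_smult_vec[OF E_vec[OF j(1) wn]] .
      finally show ?thesis .
    next
      case False
      then have "l \<in> I" "E l *\<^sub>v w = 0\<^sub>v n" using that w(3) insert.prems by auto
      then show ?thesis using Ew' by (simp add: smult_zero_vec_carrier)
    qed
    ultimately show ?case by blast
  qed
  from this[of "I - {k}"] obtain w where w: "w \<in> U" "E k *\<^sub>v w = E k *\<^sub>v u"
    "\<And>j. j \<in> I \<Longrightarrow> j \<noteq> k \<Longrightarrow> E j *\<^sub>v w = 0\<^sub>v n" by auto
  have wn: "w \<in> carrier_vec n" using vsubspaceD(1)[OF U w(1)] .
  have "w = vsum n (\<lambda>j. E j *\<^sub>v w) I" using sum_E[OF wn] by simp
  also have "\<dots> = E k *\<^sub>v w" using w(3) wn k finite_I by (intro vsum_single) auto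
  finally show ?thesis using w by simp
qed

text \<open>The lead matrix of a transform is a multiple of \<open>T\<close>, and the dual
  factorization uses a multiple of \<open>S\<close>. In both cases the projections stay the same and
  only the labels are rescaled; a nonzero factor keeps them distinct.\<close>

lemma scaled:
  assumes "c \<noteq> 0"
  shows "spectral_resolution n (c \<cdot>\<^sub>m S) I (\<lambda>i. c * a i) E"
proof
  show "inj_on (\<lambda>i. c * a i) I" using inj_a assms by (auto simp: inj_on_def)
qed (use finite_I S_carrier E_carrier sum_E E_E in
    \<open>auto simp: smult_mat_mult_vec S_E smult_smult_assoc\<close>)

text \<open>The vectors \<open>E i *\<^sub>v unit_vec n j\<close> span the space and each is zero or
  an eigenvector. A basis selected among them diagonalizes \<open>S\<close>.\<close>

lemma diagonalizable: "diagonalizable_mat S"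
proof -
  define X where "X = (\<lambda>(i, j). E i *\<^sub>v unit_vec n j) ` (I \<times> {..<n})"
  have "finite X" using finite_I by (simp add: X_def)
  then obtain xs where xs: "set xs = X" using finite_list by blast
  have Xn: "X \<subseteq> carrier_vec n" by (auto simp: X_def)
  have K: "vsubspace n {0\<^sub>v n}" by (rule vsubspaceI) auto
  obtain bs where bs: "set bs \<subseteq> X"
    and inj: "\<And>c. c \<in> carrier_vec (length bs) \<Longrightarrow> mat_of_cols n bs *\<^sub>v c = 0\<^sub>v n \<Longrightarrow> c = 0\<^sub>v (length bs)"
    and sp: "\<And>x. x \<in> X \<Longrightarrow> \<exists>c\<in>carrier_vec (length bs). x - mat_of_cols n bs *\<^sub>v c = 0\<^sub>v n"
    using basis_selection_mod_subspace[OF K, of xs] xs Xn by auto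
  define m where "m = length bs"
  define B where "B = mat_of_cols n bs"
  have B: "B \<in> carrier_mat n m" by (simp add: B_def m_def)
  note B_vec [simp] = mult_mat_vec_carrier[OF B]
  note lin_B = vlinear_mat[OF B]
  \<comment> \<open>The column space of the selected vectors. It contains every component
    \<open>E i *\<^sub>v v\<close>, and therefore all vectors.\<close>
  define W where "W = {v \<in> carrier_vec n. \<exists>c\<in>carrier_vec m. v = B *\<^sub>v c}"
  have W: "vsubspace n W"
  proof (rule vsubspaceI)
    show "0\<^sub>v n \<in> W" unfolding W_def using vlinear_zero[OF lin_B] by (auto intro!: bexI[of _ "0\<^sub>v m"])
    show "u + v \<in> W" if uv: "u \<in> W" "v \<in> W" for u v
    proof -
      obtain c d where "c \<in> carrier_vec m" "d \<in> carrier_vec m" "u = B *\<^sub>v c" "v = B *\<^sub>v d"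
        using uv by (auto simp: W_def)
      then show ?thesis using vlinearD(2)[OF lin_B] by (auto simp: W_def intro!: bexI[of _ "c + d"])
    qed
    show "k \<cdot>\<^sub>v v \<in> W" if v: "v \<in> W" for k v
    proof -
      obtain c where "c \<in> carrier_vec m" "v = B *\<^sub>v c" using v by (auto simp: W_def)
      then show ?thesis using vlinearD(3)[OF lin_B] by (auto simp: W_def intro!: bexI[of _ "k \<cdot>\<^sub>v c"])
    qed
  qed (auto simp: W_def)
  have XW: "x \<in> W" if x: "x \<in> X" for x
  proof -
    obtain c where c: "c \<in> carrier_vec m" "x - B *\<^sub>v c = 0\<^sub>v n"
      using sp[OF x] by (auto simp: m_def B_def)
    have xn: "x \<in> carrier_vec n" using x Xn by auto
    then have "x = B *\<^sub>v c" using c B_vec[OF c(1)] diff_eq_zero_vec_iff by blast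
    then show ?thesis using c(1) xn by (auto simp: W_def)
  qed
  have EW: "E i *\<^sub>v v \<in> W" if i: "i \<in> I" and v: "v \<in> carrier_vec n" for i v
  proof -
    have "E i *\<^sub>v v = E i *\<^sub>v vsum n (\<lambda>j. v $ j \<cdot>\<^sub>v unit_vec n j) {..<n}"
      by (simp add: unit_vecs_span[OF v])
    also have "\<dots> = vsum n (\<lambda>j. v $ j \<cdot>\<^sub>v (E i *\<^sub>v unit_vec n j)) {..<n}"
      using i by (subst vlinear_vsum[OF lin_E]) (auto simp: vlinearD(3)[OF lin_E])
    also have "\<dots> \<in> W"
      using i by (intro vsum_in_subspace[OF W] vsubspaceD(4)[OF W] XW) (auto simp: X_def)
    finally show ?thesis .
  qed
  have surj: "\<exists>c\<in>carrier_vec m. B *\<^sub>v c = v" if v: "v \<in> carrier_vec n" for v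
  proof -
    have "vsum n (\<lambda>i. E i *\<^sub>v v) I \<in> W" using EW v by (intro vsum_in_subspace[OF W]) auto
    then show ?thesis unfolding sum_E[OF v] by (auto simp: W_def)
  qed
  have uniq: "c = d" if cd: "c \<in> carrier_vec m" "d \<in> carrier_vec m" "B *\<^sub>v c = v" "B *\<^sub>v d = v" for c d v
  proof -
    have "B *\<^sub>v (c - d) = v - v" using vlinear_diff[OF lin_B cd(1,2)] cd by simp
    also have "v - v = 0\<^sub>v n" using B_vec[OF cd(1)] cd(3) by auto
    finally have "c - d = 0\<^sub>v m" using inj[of "c - d"] cd by (simp add: B_def m_def)
    then show "c = d" using diff_eq_zero_vec_iff cd(1,2) by blast
  qed
  have "\<exists>H. H \<in> carrier_mat m n \<and> (\<forall>v\<in>carrier_vec n. \<forall>c\<in>carrier_vec m. B *\<^sub>v c = v \<longleftrightarrow> c = H *\<^sub>v v)"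
    by (rule functional_relation_mat) (use surj uniq vlinearD(2,3)[OF lin_B] in auto)
  then obtain H where H: "H \<in> carrier_mat m n"
    and HB: "\<And>v c. v \<in> carrier_vec n \<Longrightarrow> c \<in> carrier_vec m \<Longrightarrow> B *\<^sub>v c = v \<longleftrightarrow> c = H *\<^sub>v v"
    by blast
  have inv: "B *\<^sub>v (H *\<^sub>v v) = v" if "v \<in> carrier_vec n" for v
    using HB[OF that, of "H *\<^sub>v v"] mult_mat_vec_carrier[OF H that] by simp
  have inv': "H *\<^sub>v (B *\<^sub>v c) = c" if "c \<in> carrier_vec m" for c
    using HB[of "B *\<^sub>v c" c] that by simp
  note sq = inverse_mats_square[OF B H inv inv']
  have mn: "m = n" using sq(1) by simp
  have "\<exists>\<beta>. S *\<^sub>v col B j = \<beta> \<cdot>\<^sub>v col B j" if "j < n" for j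
  proof -
    have j: "j < length bs" using that mn by (simp add: m_def)
    then have "bs ! j \<in> X" using bs by auto
    moreover from this have "col B j = bs ! j"
      using j Xn unfolding B_def by (intro col_mat_of_cols) auto
    ultimately obtain i l where "i \<in> I" "col B j = E i *\<^sub>v unit_vec n l" by (auto simp: X_def)
    then show ?thesis using S_E by auto
  qed
  then obtain \<beta> where \<beta>: "\<And>j. j < n \<Longrightarrow> S *\<^sub>v col B j = \<beta> j \<cdot>\<^sub>v col B j" by metis
  define D where "D = mat n n (\<lambda>(i, j). if i = j then \<beta> j else 0)"
  have D: "D \<in> carrier_mat n n" by (simp add: D_def)
  have B': "B \<in> carrier_mat n n" and H': "H \<in> carrier_mat n n" using B H mn by auto
  have "S * B = B * D"
  proof (rule mat_col_eqI)
    fix j assume "j < dim_col (B * D)"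
    then have j: "j < n" using D by simp
    have "col D j = \<beta> j \<cdot>\<^sub>v unit_vec n j" using j by (intro eq_vecI) (auto simp: D_def)
    then have "B *\<^sub>v col D j = \<beta> j \<cdot>\<^sub>v col B j"
      using j mult_mat_vec[OF B', of "unit_vec n j"] mat_mult_unit_vec[OF B' j] by simp
    then show "col (S * B) j = col (B * D) j"
      using \<beta>[OF j] col_mult2[OF S_carrier B' j] col_mult2[OF B' D j] by simp
  qed (use S_carrier B' D in auto)
  then have "S * (B * H) = B * D * H"
    using assoc_mult_mat[OF S_carrier B' H'] by simp
  then have "S = B * D * H" using sq(2) S_carrier by simp
  then have "similar_mat S D"
    using S_carrier D B' H' sq mn by (intro similar_matI[of _ _ B H n]) auto
  moreover have "diagonal_mat D" by (auto simp: diagonal_mat_def D_def)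
  ultimately show ?thesis by (auto simp: diagonalizable_mat_def)
qed

end

text \<open>After diagonalization the projection for \<alpha> keeps the coordinates whose diagonal
  entry is \<alpha>. The labels are only required to cover the spectrum, so the same lemma applies
  to \<open>S\<close> with its eigenvalues and to \<open>T\<close> with all singular points.\<close>

lemma diagonalizable_spectral_resolution:
  assumes S: "S \<in> carrier_mat n n" and diag: "diagonalizable_mat S"
    and I: "finite I" "inj_on a I" and ev: "{\<alpha>. eigenvalue S \<alpha>} \<subseteq> a ` I"
  shows "spectral_resolution n S I a (\<lambda>i. eigenproj S (a i))"
proof -
  obtain D where D: "diagonal_mat D" "similar_mat S D"
    using diag by (auto simp: diagonalizable_mat_def)
  obtain k P Q where PQ: "{S, D, P, Q} \<subseteq> carrier_mat k k" "P * Q = 1\<^sub>m k" "Q * P = 1\<^sub>m k"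
    "S = P * D * Q"
    using similar_matD[OF D(2)] by auto
  have "k = n" using S PQ(1) by auto
  note PQ = PQ[unfolded this]
  have Dc: "D \<in> carrier_mat n n" and P: "P \<in> carrier_mat n n" and Q: "Q \<in> carrier_mat n n"
    using PQ(1) by auto
  note vec [simp] = mult_mat_vec_carrier[OF P] mult_mat_vec_carrier[OF Q] mult_mat_vec_carrier[OF Dc]
  have PQv: "P *\<^sub>v (Q *\<^sub>v v) = v" and QPv: "Q *\<^sub>v (P *\<^sub>v v) = v" if "v \<in> carrier_vec n" for v
    using assoc_mult_mat_vec[OF P Q that] assoc_mult_mat_vec[OF Q P that] PQ(2,3) that by auto
  have Sv: "S *\<^sub>v v = P *\<^sub>v (D *\<^sub>v (Q *\<^sub>v v))" if "v \<in> carrier_vec n" for v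
    using assoc_mult_mat_vec[OF mult_carrier_mat[OF P Dc] Q that]
      assoc_mult_mat_vec[OF P Dc mult_mat_vec_carrier[OF Q that]] PQ(4) by simp
  \<comment> \<open>The projection onto the \<alpha>-eigenspace of the diagonal matrix
    \<open>D\<close>; conjugating it back by \<open>P\<close> and \<open>Q\<close> gives the
    projection for \<open>S\<close>.\<close>
  define \<Delta> :: "complex \<Rightarrow> complex vec \<Rightarrow> complex vec"
    where "\<Delta> \<alpha> v = vec n (\<lambda>i. if D $$ (i, i) = \<alpha> then v $ i else 0)" for \<alpha> v
  have lin_\<Delta>: "vlinear n n (\<Delta> \<alpha>)" for \<alpha>
    by (rule vlinearI) (auto simp: \<Delta>_def intro!: eq_vecI)
  have \<Delta>_carrier [simp]: "\<Delta> \<alpha> v \<in> carrier_vec n" for \<alpha> v by (simp add: \<Delta>_def)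
  have D_\<Delta>: "D *\<^sub>v \<Delta> \<alpha> v = \<alpha> \<cdot>\<^sub>v \<Delta> \<alpha> v" for \<alpha> v
  proof (rule eq_vecI)
    fix i assume "i < dim_vec (\<alpha> \<cdot>\<^sub>v \<Delta> \<alpha> v)"
    then have i: "i < n" by (simp add: \<Delta>_def)
    have "(D *\<^sub>v \<Delta> \<alpha> v) $ i = (\<Sum>j<n. D $$ (i, j) * \<Delta> \<alpha> v $ j)"
      using Dc i by (auto simp: scalar_prod_def lessThan_atLeast0 \<Delta>_def intro!: sum.cong)
    also have "\<dots> = (\<Sum>j<n. if j = i then D $$ (i, i) * \<Delta> \<alpha> v $ i else 0)"
      using D(1) Dc i by (intro sum.cong) (auto simp: diagonal_mat_def)
    also have "\<dots> = (\<alpha> \<cdot>\<^sub>v \<Delta> \<alpha> v) $ i" using i by (auto simp: \<Delta>_def)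
    finally show "(D *\<^sub>v \<Delta> \<alpha> v) $ i = (\<alpha> \<cdot>\<^sub>v \<Delta> \<alpha> v) $ i" .
  qed (use Dc in \<open>simp add: \<Delta>_def\<close>)
  \<comment> \<open>The diagonal entries are needed for the projections to add up to the identity,
    the values of \<open>a\<close> for the labels asked for. The surplus labels are removed
    afterwards by \<open>E0\<close>.\<close>
  define \<Lambda> where "\<Lambda> = (\<lambda>i. D $$ (i, i)) ` {..<n} \<union> a ` I"
  have fin: "finite \<Lambda>" using I by (simp add: \<Lambda>_def)
  have sum_\<Delta>: "vsum n (\<lambda>\<alpha>. \<Delta> \<alpha> v) \<Lambda> = v" if v: "v \<in> carrier_vec n" for v
  proof (rule eq_vecI)
    fix i assume "i < dim_vec v"
    then have i: "i < n" using v by auto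
    have "(\<Sum>\<alpha>\<in>\<Lambda>. \<Delta> \<alpha> v $ i) = (\<Sum>\<alpha>\<in>\<Lambda>. if D $$ (i, i) = \<alpha> then v $ i else 0)"
      using i by (simp add: \<Delta>_def)
    also have "\<dots> = v $ i" using fin i by (auto simp: \<Lambda>_def)
    finally show "vsum n (\<lambda>\<alpha>. \<Delta> \<alpha> v) \<Lambda> $ i = v $ i" using i by (simp add: vsum_def)
  qed (use v in \<open>auto simp: vsum_def\<close>)
  define E where "E \<alpha> = mat_of_fun n n (\<lambda>v. P *\<^sub>v \<Delta> \<alpha> (Q *\<^sub>v v))" for \<alpha>
  have E_carrier: "E \<alpha> \<in> carrier_mat n n" for \<alpha> by (simp add: E_def)
  have Ev: "E \<alpha> *\<^sub>v v = P *\<^sub>v \<Delta> \<alpha> (Q *\<^sub>v v)" if "v \<in> carrier_vec n" for \<alpha> v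
    unfolding E_def
    using vlinear_comp[OF vlinear_comp[OF vlinear_mat[OF Q] lin_\<Delta>] vlinear_mat[OF P]] that
    by (rule mat_of_fun_mult)
  interpret R: spectral_resolution n S \<Lambda> id E
  proof
    show "finite \<Lambda>" "inj_on id \<Lambda>" "S \<in> carrier_mat n n" using fin S by auto
    show "E \<alpha> \<in> carrier_mat n n" for \<alpha> by (rule E_carrier)
    show "vsum n (\<lambda>\<alpha>. E \<alpha> *\<^sub>v v) \<Lambda> = v" if v: "v \<in> carrier_vec n" for v
      using vlinear_vsum[OF vlinear_mat[OF P] fin, of "\<lambda>\<alpha>. \<Delta> \<alpha> (Q *\<^sub>v v)"] v
      by (simp add: Ev sum_\<Delta> PQv)
    show "S *\<^sub>v (E \<alpha> *\<^sub>v v) = id \<alpha> \<cdot>\<^sub>v (E \<alpha> *\<^sub>v v)" if "v \<in> carrier_vec n" for \<alpha> v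
      using that by (simp add: Ev Sv QPv D_\<Delta> vlinearD(3)[OF vlinear_mat[OF P]])
    show "E \<alpha> *\<^sub>v (E \<beta> *\<^sub>v v) = (if \<alpha> = \<beta> then E \<alpha> *\<^sub>v v else 0\<^sub>v n)"
      if v: "v \<in> carrier_vec n" for \<alpha> \<beta> v
    proof -
      have "\<Delta> \<alpha> (\<Delta> \<beta> w) = (if \<alpha> = \<beta> then \<Delta> \<alpha> w else 0\<^sub>v n)" for w
        by (auto simp: \<Delta>_def intro!: eq_vecI)
      then show ?thesis
        using v by (simp add: Ev QPv vlinear_zero[OF vlinear_mat[OF P]])
    qed
  qed
  have proj: "eigenproj S \<alpha> = E \<alpha>" if "\<alpha> \<in> a ` I" for \<alpha>
    using R.eigenproj_eq[of \<alpha>] that by (simp add: \<Lambda>_def)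
  \<comment> \<open>A nonzero vector in the range of such a projection would be an eigenvector, and
    its eigenvalue would belong to the values of \<open>a\<close>.\<close>
  have E0: "E \<alpha> *\<^sub>v v = 0\<^sub>v n" if "\<alpha> \<in> \<Lambda>" "\<alpha> \<notin> a ` I" "v \<in> carrier_vec n" for \<alpha> v
  proof (rule ccontr)
    assume "E \<alpha> *\<^sub>v v \<noteq> 0\<^sub>v n"
    then have "eigenvalue S \<alpha>" unfolding eigenvalue_def eigenvector_def
      using S R.S_E[OF that(1,3)] R.E_vec[OF that(1,3)] by auto
    then show False using ev that(2) by auto
  qed
  show ?thesis
  proof
    show "vsum n (\<lambda>i. eigenproj S (a i) *\<^sub>v v) I = v" if v: "v \<in> carrier_vec n" for v
    proof -
      have "(\<Sum>i\<in>I. (eigenproj S (a i) *\<^sub>v v) $ r) = (\<Sum>\<alpha>\<in>\<Lambda>. (E \<alpha> *\<^sub>v v) $ r)" if r: "r < n" for r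
      proof -
        have "(\<Sum>i\<in>I. (eigenproj S (a i) *\<^sub>v v) $ r) = (\<Sum>\<alpha>\<in>a ` I. (E \<alpha> *\<^sub>v v) $ r)"
          using I(2) by (simp add: sum.reindex proj del: index_mult_mat_vec)
        also have "\<dots> = (\<Sum>\<alpha>\<in>\<Lambda>. (E \<alpha> *\<^sub>v v) $ r)"
          using fin E0 v r by (intro sum.mono_neutral_left) (auto simp: \<Lambda>_def simp del: index_mult_mat_vec)
        finally show ?thesis .
      qed
      then have "vsum n (\<lambda>i. eigenproj S (a i) *\<^sub>v v) I = vsum n (\<lambda>\<alpha>. E \<alpha> *\<^sub>v v) \<Lambda>"
        by (intro eq_vecI) (auto simp: vsum_def simp del: index_mult_mat_vec)
      then show ?thesis using R.sum_E[OF v] by simp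
    qed
    show "eigenproj S (a i) *\<^sub>v (eigenproj S (a j) *\<^sub>v v) = 
      (if i = j then eigenproj S (a i) *\<^sub>v v else 0\<^sub>v n)"
      if "i \<in> I" "j \<in> I" "v \<in> carrier_vec n" for i j v
      using that R.E_E[of "a i" "a j" v] I(2) by (auto simp: proj \<Lambda>_def dest: inj_onD)
  qed (use I S R.S_E in \<open>auto simp: proj E_carrier \<Lambda>_def\<close>)
qed

lemma finite_eigenvalues:
  fixes S :: "complex mat"
  assumes "S \<in> carrier_mat n n"
  shows "finite {\<alpha>. eigenvalue S \<alpha>}"
proof -
  have "char_poly S \<noteq> 0" using degree_monic_char_poly[OF assms] by auto
  then show ?thesis
    using poly_roots_finite[of "char_poly S"] eigenvalue_root_char_poly[OF assms] by simp
qed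

section \<open>Minimal factorizations of the coefficient matrix\<close>

lemma admissibleD:
  assumes "admissible e"
  shows "eq_size e \<ge> 1" "lead_mat e \<in> carrier_mat (eq_size e) (eq_size e)"
    "length (res_mats e) = num_pts e" "length (sing_pts e) = num_pts e"
    "\<And>k. k < num_pts e \<Longrightarrow> res_mats e ! k \<in> carrier_mat (eq_size e) (eq_size e)"
    "distinct (sing_pts e)" "diagonalizable_mat (lead_mat e)"
  using assms by (auto simp: admissible_def num_pts_def)

lemma irreducible_eqD:
  assumes "admissible e" "irreducible_eq e" and W: "vsubspace (eq_size e) W"
    and "\<And>w. w \<in> W \<Longrightarrow> lead_mat e *\<^sub>v w \<in> W"
    and "\<And>k w. k < num_pts e \<Longrightarrow> w \<in> W \<Longrightarrow> res_mats e ! k *\<^sub>v w \<in> W"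
  shows "W = {0\<^sub>v (eq_size e)} \<or> W = carrier_vec (eq_size e)"
proof -
  have "B *\<^sub>v w \<in> W" if "B \<in> insert (lead_mat e) (set (res_mats e))" "w \<in> W" for B w
  proof (cases "B = lead_mat e")
    case False
    then have "B \<in> set (res_mats e)" using that(1) by simp
    then obtain k where "k < num_pts e" "B = res_mats e ! k"
      using admissibleD(3)[OF assms(1)] by (metis in_set_conv_nth)
    then show ?thesis using assms(5)[OF _ that(2)] by simp
  qed (simp add: assms(4)[OF that(2)])
  then show ?thesis
    using assms(2)[unfolded irreducible_eq_def subspace_module_vec_iff, rule_format, of W] W by simp
qed

lemma irreducible_eqI:
  assumes "admissible e"
    and "\<And>W. vsubspace (eq_size e) W \<Longrightarrow> (\<And>w. w \<in> W \<Longrightarrow> lead_mat e *\<^sub>v w \<in> W) \<Longrightarrow>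
      (\<And>k w. k < num_pts e \<Longrightarrow> w \<in> W \<Longrightarrow> res_mats e ! k *\<^sub>v w \<in> W) \<Longrightarrow>
      W = {0\<^sub>v (eq_size e)} \<or> W = carrier_vec (eq_size e)"
  shows "irreducible_eq e"
  unfolding irreducible_eq_def subspace_module_vec_iff
proof (intro allI impI, elim conjE)
  fix W assume W: "vsubspace (eq_size e) W"
    and inv: "\<forall>B\<in>insert (lead_mat e) (set (res_mats e)). \<forall>w\<in>W. B *\<^sub>v w \<in> W"
  show "W = {0\<^sub>v (eq_size e)} \<or> W = carrier_vec (eq_size e)"
  proof (rule assms(2)[OF W])
    show "lead_mat e *\<^sub>v w \<in> W" if "w \<in> W" for w
      using bspec[OF inv, of "lead_mat e"] that by simp
    show "res_mats e ! k *\<^sub>v w \<in> W" if "k < num_pts e" "w \<in> W" for k w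
      using bspec[OF inv, of "res_mats e ! k"] that admissibleD(3)[OF assms(1)] by simp
  qed
qed

lemma lead_resolution:
  assumes "admissible e"
  shows "spectral_resolution (eq_size e) (lead_mat e) {\<alpha>. eigenvalue (lead_mat e) \<alpha>} id
    (eigenproj (lead_mat e))"
  using diagonalizable_spectral_resolution[OF admissibleD(2,7)[OF assms] finite_eigenvalues,
      of "lead_mat e" "eq_size e" id] admissibleD(2)[OF assms] by simp

text \<open>A nonzero such \<open>v\<close> spans an invariant line. By irreducibility the line is
  the whole space, so the size is 1 and every residue acts as zero, which is the exceptional case.
  All uses of non-exceptionality of the given equation go through this lemma.\<close>

lemma eigenvector_common_kernel:
  assumes adm: "admissible e" and irr: "irreducible_eq e" and nexc: "\<not> exceptional e"
    and v: "v \<in> carrier_vec (eq_size e)" and eig: "lead_mat e *\<^sub>v v = \<alpha> \<cdot>\<^sub>v v"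
    and ker: "\<And>k. k < num_pts e \<Longrightarrow> res_mats e ! k *\<^sub>v v = 0\<^sub>v (eq_size e)"
  shows "v = 0\<^sub>v (eq_size e)"
proof (rule ccontr)
  assume v0: "v \<noteq> 0\<^sub>v (eq_size e)"
  define n where "n = eq_size e"
  note a = admissibleD[OF adm, folded n_def]
  note v = v[folded n_def] and v0 = v0[folded n_def] and ker = ker[folded n_def]
  define W where "W = range (\<lambda>c. c \<cdot>\<^sub>v v)"
  have W: "vsubspace n W"
  proof (rule vsubspaceI)
    show "0\<^sub>v n \<in> W" 
      unfolding W_def by (rule range_eqI[where x = 0]) (simp add: zero_smult_vec[OF v])
    show "u + w \<in> W" if u: "u \<in> W" and w: "w \<in> W" for u w
    proof -
      obtain c where "u = c \<cdot>\<^sub>v v" using u unfolding W_def by blast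
      moreover obtain d where "w = d \<cdot>\<^sub>v v" using w unfolding W_def by blast
      ultimately show ?thesis
        unfolding W_def by (intro range_eqI[where x = "c + d"]) (simp add: add_smult_distrib_vec)
    qed
    show "c \<cdot>\<^sub>v w \<in> W" if w: "w \<in> W" for c w
    proof -
      obtain d where "w = d \<cdot>\<^sub>v v" using w unfolding W_def by blast
      then show ?thesis
        unfolding W_def by (intro range_eqI[where x = "c * d"]) (simp add: smult_smult_assoc)
    qed
  qed (use v in \<open>auto simp: W_def\<close>)
  have S: "lead_mat e *\<^sub>v w \<in> W" if w: "w \<in> W" for w
  proof -
    obtain d where "w = d \<cdot>\<^sub>v v" using w unfolding W_def by blast
    then have "lead_mat e *\<^sub>v w = (d * \<alpha>) \<cdot>\<^sub>v v"
      using mult_mat_vec[OF a(2) v] eig by (simp add: smult_smult_assoc)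
    then show ?thesis unfolding W_def by blast
  qed
  have A0: "res_mats e ! k *\<^sub>v w = 0\<^sub>v n" if k: "k < num_pts e" and w: "w \<in> W" for k w
  proof -
    obtain d where "w = d \<cdot>\<^sub>v v" using w unfolding W_def by blast
    then show ?thesis
      using mult_mat_vec[OF a(5)[OF k] v] ker[OF k] by (simp add: smult_zero_vec_carrier)
  qed
  have A: "res_mats e ! k *\<^sub>v w \<in> W" if "k < num_pts e" "w \<in> W" for k w
    using A0[OF that] vsubspaceD(2)[OF W] by simp
  have "W = {0\<^sub>v n} \<or> W = carrier_vec n"
    using irreducible_eqD[OF adm irr W[unfolded n_def] S A] by (simp add: n_def)
  moreover have "v \<in> W" 
    unfolding W_def by (rule range_eqI[where x = 1]) (simp add: one_smult_vec)
  ultimately have W: "W = carrier_vec n" using v0 by auto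
  \<comment> \<open>In larger size two different unit vectors would both be multiples of
    \<open>v\<close>.\<close>
  have "n = 1"
  proof (rule ccontr)
    assume "n \<noteq> 1"
    then have n2: "0 < n" "1 < n" using a(1) by auto
    have "unit_vec n 0 \<in> W" "unit_vec n 1 \<in> W" using W by auto
    then obtain c d where c: "unit_vec n 0 = c \<cdot>\<^sub>v v" and d: "unit_vec n 1 = d \<cdot>\<^sub>v v"
      unfolding W_def by blast
    have "c * v $ 0 = 1" "c * v $ 1 = 0" "d * v $ 1 = 1"
      using arg_cong[OF c, of "\<lambda>x. x $ 0"] arg_cong[OF c, of "\<lambda>x. x $ 1"]
        arg_cong[OF d, of "\<lambda>x. x $ 1"] n2 v by auto
    then show False by auto
  qed
  moreover have "A = 0\<^sub>m n n" if A: "A \<in> set (res_mats e)" for A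
  proof -
    obtain k where k: "k < num_pts e" "A = res_mats e ! k" using A a(3) by (metis in_set_conv_nth)
    show ?thesis
    proof (rule mat_eq_vecI[of _ n n])
      show "A *\<^sub>v w = 0\<^sub>m n n *\<^sub>v w" if "w \<in> carrier_vec n" for w
      proof -
        have "0\<^sub>m n n *\<^sub>v w = 0\<^sub>v n" using that by (intro eq_vecI) auto
        then show ?thesis using A0[OF k(1), of w] that by (simp add: k(2) W)
      qed
    qed (use a(5)[OF k(1)] k(2) in auto)
  qed
  ultimately show False using nexc by (auto simp: exceptional_def n_def)
qed

text \<open>The last two conditions express that \<open>T\<close> has least possible size.\<close>

locale realization =
  fixes e :: equation and M :: nat and T Q P :: "complex mat"
  assumes adm: "admissible e"
    and T_carrier: "T \<in> carrier_mat M M" and T_diag: "diagonalizable_mat T"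
    and T_eigenvalues: "{\<alpha>. eigenvalue T \<alpha>} \<subseteq> set (sing_pts e)"
    and Q_carrier: "Q \<in> carrier_mat (eq_size e) M"
    and P_carrier: "P \<in> carrier_mat M (eq_size e)"
    and res_factor: "k < num_pts e \<Longrightarrow> res_mats e ! k = Q * (eigenproj T (sing_pts e ! k) * P)"
    and Q_inj: "k < num_pts e \<Longrightarrow> w \<in> carrier_vec M \<Longrightarrow> T *\<^sub>v w = (sing_pts e ! k) \<cdot>\<^sub>v w \<Longrightarrow>
      Q *\<^sub>v w = 0\<^sub>v (eq_size e) \<Longrightarrow> w = 0\<^sub>v M"
    and P_surj: "k < num_pts e \<Longrightarrow> w \<in> carrier_vec M \<Longrightarrow> T *\<^sub>v w = (sing_pts e ! k) \<cdot>\<^sub>v w \<Longrightarrow>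
      \<exists>v\<in>carrier_vec (eq_size e). w = eigenproj T (sing_pts e ! k) *\<^sub>v (P *\<^sub>v v)"
begin

abbreviation "N \<equiv> eq_size e"
abbreviation "q \<equiv> num_pts e"
abbreviation "S \<equiv> lead_mat e"
abbreviation "A k \<equiv> res_mats e ! k"
abbreviation "F k \<equiv> eigenproj T (sing_pts e ! k)"
abbreviation "E \<alpha> \<equiv> eigenproj S \<alpha>"
abbreviation "spec \<equiv> {\<alpha>. eigenvalue S \<alpha>}"

sublocale T: spectral_resolution M T "{..<q}" "\<lambda>k. sing_pts e ! k" F
proof (rule diagonalizable_spectral_resolution[OF T_carrier T_diag])
  show "inj_on ((!) (sing_pts e)) {..<q}"
    using admissibleD(4,6)[OF adm] by (auto simp: inj_on_def nth_eq_iff_index_eq)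
  show "{\<alpha>. eigenvalue T \<alpha>} \<subseteq> (!) (sing_pts e) ` {..<q}"
    using T_eigenvalues admissibleD(4)[OF adm] by (force simp: in_set_conv_nth)
qed simp

sublocale S: spectral_resolution N S spec id E
  by (rule lead_resolution[OF adm])

lemma Q_vec [simp]: "w \<in> carrier_vec M \<Longrightarrow> Q *\<^sub>v w \<in> carrier_vec N"
  using mult_mat_vec_carrier[OF Q_carrier] .

lemma P_vec [simp]: "v \<in> carrier_vec N \<Longrightarrow> P *\<^sub>v v \<in> carrier_vec M"
  using mult_mat_vec_carrier[OF P_carrier] .

lemmas lin_Q = vlinear_mat[OF Q_carrier]
lemmas lin_P = vlinear_mat[OF P_carrier]

lemma A_vec: "k < q \<Longrightarrow> v \<in> carrier_vec N \<Longrightarrow> A k *\<^sub>v v = Q *\<^sub>v (F k *\<^sub>v (P *\<^sub>v v))"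
  using assoc_mult_mat_vec[OF Q_carrier mult_carrier_mat[OF T.E_carrier P_carrier]]
    assoc_mult_mat_vec[OF T.E_carrier P_carrier] by (simp add: res_factor)

text \<open>Each \<open>F k\<close> component of the difference lies in an eigenspace of
  \<open>T\<close>, where \<open>Q\<close> is injective, so all components vanish. In the language
  of linear systems this is observability, and it is the way in which identities in the state space
  are proved below.\<close>

lemma eq_if_Q_F_eq:
  assumes u: "u \<in> carrier_vec M" and v: "v \<in> carrier_vec M"
    and eq: "\<And>k. k < q \<Longrightarrow> Q *\<^sub>v (F k *\<^sub>v u) = Q *\<^sub>v (F k *\<^sub>v v)"
  shows "u = v"
proof -
  have "F k *\<^sub>v (u - v) = 0\<^sub>v M" if k: "k < q" for k
  proof (rule Q_inj[OF k])
    have "Q *\<^sub>v (F k *\<^sub>v (u - v)) = Q *\<^sub>v (F k *\<^sub>v u) - Q *\<^sub>v (F k *\<^sub>v v)"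
      using k u v by (simp add: vlinear_diff[OF T.lin_E] vlinear_diff[OF lin_Q])
    then show "Q *\<^sub>v (F k *\<^sub>v (u - v)) = 0\<^sub>v N" using eq[OF k] k v by simp
  qed (use k u v in \<open>auto simp: T.S_E\<close>)
  then have "vsum M (\<lambda>k. F k *\<^sub>v (u - v)) {..<q} = vsum M (\<lambda>k. 0\<^sub>v M) {..<q}"
    by (intro vsum_cong) simp
  also have "\<dots> = 0\<^sub>v M" by (intro eq_vecI) (auto simp: vsum_def)
  finally show "u = v" using T.sum_E[of "u - v"] u v diff_eq_zero_vec_iff by simp
qed

text \<open>The counterpart of observability, read off from \<open>P_surj\<close>. The vector
  \<open>v\<close> depends on \<open>k\<close>.\<close>

lemma F_eq_F_P:
  assumes "k < q" "w \<in> carrier_vec M"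
  shows "\<exists>v\<in>carrier_vec N. F k *\<^sub>v w = F k *\<^sub>v (P *\<^sub>v v)"
  using P_surj[of k "F k *\<^sub>v w"] assms by (simp add: T.S_E)

end

text \<open>The stated equations determine the image of \<open>w\<close>, because the second
  factorization is observable. They are solvable because \<open>F k *\<^sub>v w\<close> has the form
  \<open>F k *\<^sub>v (P *\<^sub>v v)\<close>, so that the prescribed value is a residue applied to
  \<open>v\<close>, and the residues are common to both factorizations.\<close>

lemma realizations_intertwiner:
  assumes "realization e M T Q P" "realization e M' T' Q' P'"
  obtains G where "G \<in> carrier_mat M' M"
    "\<And>k w. k < num_pts e \<Longrightarrow> w \<in> carrier_vec M \<Longrightarrow>
      Q' *\<^sub>v (eigenproj T' (sing_pts e ! k) *\<^sub>v (G *\<^sub>v w)) = Q *\<^sub>v (eigenproj T (sing_pts e ! k) *\<^sub>v w)"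
proof -
  interpret R: realization e M T Q P by fact
  interpret R': realization e M' T' Q' P' by fact
  define rel where "rel w w' \<longleftrightarrow> (\<forall>k<num_pts e. Q' *\<^sub>v (R'.F k *\<^sub>v w') = Q *\<^sub>v (R.F k *\<^sub>v w))" for w w'
  have ex: "\<exists>w'\<in>carrier_vec M'. rel w w'" if w: "w \<in> carrier_vec M" for w
  proof -
    obtain v where v: "\<And>k. k < num_pts e \<Longrightarrow> v k \<in> carrier_vec (eq_size e) \<and>
        R.F k *\<^sub>v w = R.F k *\<^sub>v (P *\<^sub>v v k)"
      using R.F_eq_F_P[OF _ w] by metis
    \<comment> \<open>The vectors \<open>v k\<close> differ from one \<open>k\<close> to the next,
      so the image is assembled from their projections; applying \<open>R'.F l\<close> then recovers
      the \<open>l\<close>-th piece.\<close>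
    define w' where "w' = vsum M' (\<lambda>k. R'.F k *\<^sub>v (P' *\<^sub>v v k)) {..<num_pts e}"
    have "R'.F l *\<^sub>v w' = R'.F l *\<^sub>v (P' *\<^sub>v v l)" if l: "l < num_pts e" for l
    proof -
      have "R'.F l *\<^sub>v w' = vsum M' (\<lambda>k. R'.F l *\<^sub>v (R'.F k *\<^sub>v (P' *\<^sub>v v k))) {..<num_pts e}"
        unfolding w'_def using l v by (intro vlinear_vsum[OF R'.T.lin_E]) auto
      also have "\<dots> = R'.F l *\<^sub>v (R'.F l *\<^sub>v (P' *\<^sub>v v l))"
        using l v by (intro vsum_single) (auto simp: R'.T.E_E)
      also have "\<dots> = R'.F l *\<^sub>v (P' *\<^sub>v v l)" using l v by (simp add: R'.T.E_E)
      finally show ?thesis .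
    qed
    then have "rel w w'" using v R.A_vec R'.A_vec by (simp add: rel_def)
    then show ?thesis by (auto simp: w'_def)
  qed
  have un: "c = d" if "v \<in> carrier_vec M" "c \<in> carrier_vec M'" "d \<in> carrier_vec M'" "rel v c" "rel v d" for v c d
    by (rule R'.eq_if_Q_F_eq)
      (use that in \<open>simp_all add: rel_def\<close>)
  have add: "rel (u + v) (c + d)"
    if "u \<in> carrier_vec M" "v \<in> carrier_vec M" "c \<in> carrier_vec M'" "d \<in> carrier_vec M'"
      "rel u c" "rel v d" for u v c d
    using that by (simp add: rel_def vlinearD(2)[OF R.T.lin_E] vlinearD(2)[OF R'.T.lin_E]
        vlinearD(2)[OF R.lin_Q] vlinearD(2)[OF R'.lin_Q])
  have smult: "rel (k \<cdot>\<^sub>v v) (k \<cdot>\<^sub>v c)" if "v \<in> carrier_vec M" "c \<in> carrier_vec M'" "rel v c" for k v c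
    using that by (simp add: rel_def vlinearD(3)[OF R.T.lin_E] vlinearD(3)[OF R'.T.lin_E]
        vlinearD(3)[OF R.lin_Q] vlinearD(3)[OF R'.lin_Q])
  have "\<exists>G. G \<in> carrier_mat M' M \<and> (\<forall>w\<in>carrier_vec M. \<forall>w'\<in>carrier_vec M'. rel w w' \<longleftrightarrow> w' = G *\<^sub>v w)"
    by (rule functional_relation_mat) (fact ex un add smult)+
  then obtain G where G: "G \<in> carrier_mat M' M"
    and Grel: "\<And>w w'. w \<in> carrier_vec M \<Longrightarrow> w' \<in> carrier_vec M' \<Longrightarrow> rel w w' \<longleftrightarrow> w' = G *\<^sub>v w"
    by blast
  show ?thesis
  proof (rule that[OF G])
    show "Q' *\<^sub>v (R'.F k *\<^sub>v (G *\<^sub>v w)) = Q *\<^sub>v (R.F k *\<^sub>v w)"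
      if "k < num_pts e" "w \<in> carrier_vec M" for k w
      using Grel[of w "G *\<^sub>v w"] mult_mat_vec_carrier[OF G] that by (simp add: rel_def)
  qed
qed

text \<open>This is the uniqueness of minimal realizations up to change of state coordinates. The
  intertwiners in the two directions are inverse to each other, and they carry \<open>T\<close>,
  \<open>Q\<close> and \<open>P\<close> over, since in each case both sides have the same image
  under \<open>Q'\<close> after every spectral projection.\<close>

lemma realizations_conjugate:
  assumes "realization e M T Q P" "realization e M' T' Q' P'"
  obtains G H where "M' = M" "G \<in> carrier_mat M M" "H \<in> carrier_mat M M"
    "G * H = 1\<^sub>m M" "H * G = 1\<^sub>m M" "T' = G * T * H" "Q' = Q * H" "P' = G * P"
proof -
  interpret R: realization e M T Q P by fact
  interpret R': realization e M' T' Q' P' by fact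
  obtain G where G: "G \<in> carrier_mat M' M"
    and QG: "\<And>k w. k < num_pts e \<Longrightarrow> w \<in> carrier_vec M \<Longrightarrow>
      Q' *\<^sub>v (R'.F k *\<^sub>v (G *\<^sub>v w)) = Q *\<^sub>v (R.F k *\<^sub>v w)"
    using realizations_intertwiner[OF assms] by metis
  obtain H where H: "H \<in> carrier_mat M M'"
    and QH: "\<And>k w. k < num_pts e \<Longrightarrow> w \<in> carrier_vec M' \<Longrightarrow>
      Q *\<^sub>v (R.F k *\<^sub>v (H *\<^sub>v w)) = Q' *\<^sub>v (R'.F k *\<^sub>v w)"
    using realizations_intertwiner[OF assms(2,1)] by metis
  note [simp] = mult_mat_vec_carrier[OF G] mult_mat_vec_carrier[OF H]
  have GH: "G *\<^sub>v (H *\<^sub>v w) = w" if "w \<in> carrier_vec M'" for w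
    by (rule R'.eq_if_Q_F_eq)
      (use that in \<open>simp_all add: QG QH\<close>)
  have HG: "H *\<^sub>v (G *\<^sub>v w) = w" if "w \<in> carrier_vec M" for w
    by (rule R.eq_if_Q_F_eq)
      (use that in \<open>simp_all add: QG QH\<close>)
  note inv = inverse_mats_square[OF G H GH HG]
  have MM: "M' = M" by (rule inv(1))
  \<comment> \<open>On both sides the test with index \<open>k\<close> gives
    \<open>sing_pts e ! k\<close> times \<open>Q *\<^sub>v (R.F k *\<^sub>v w)\<close>.\<close>
  have TG: "T' *\<^sub>v (G *\<^sub>v w) = G *\<^sub>v (T *\<^sub>v w)" if w: "w \<in> carrier_vec M" for w
    by (rule R'.eq_if_Q_F_eq)
      (use w in \<open>simp_all add: QG R.T.E_S R'.T.E_S vlinearD(3)[OF R.lin_Q] vlinearD(3)[OF R'.lin_Q]\<close>)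
  have QG': "Q' *\<^sub>v (G *\<^sub>v w) = Q *\<^sub>v w" if w: "w \<in> carrier_vec M" for w
  proof -
    have "Q' *\<^sub>v (G *\<^sub>v w) = Q' *\<^sub>v vsum M' (\<lambda>k. R'.F k *\<^sub>v (G *\<^sub>v w)) {..<num_pts e}"
      using w by (simp add: R'.T.sum_E)
    also have "\<dots> = vsum (eq_size e) (\<lambda>k. Q *\<^sub>v (R.F k *\<^sub>v w)) {..<num_pts e}"
      using w by (subst vlinear_vsum[OF R'.lin_Q]) (auto simp: QG intro!: vsum_cong)
    also have "\<dots> = Q *\<^sub>v vsum M (\<lambda>k. R.F k *\<^sub>v w) {..<num_pts e}"
      using w by (subst vlinear_vsum[OF R.lin_Q]) auto
    finally show ?thesis using w by (simp add: R.T.sum_E)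
  qed
  \<comment> \<open>On both sides the test with index \<open>k\<close> gives the residue
    \<open>res_mats e ! k\<close> applied to \<open>v\<close>.\<close>
  have PG: "P' *\<^sub>v v = G *\<^sub>v (P *\<^sub>v v)" if v: "v \<in> carrier_vec (eq_size e)" for v
    by (rule R'.eq_if_Q_F_eq)
      (use v in \<open>simp_all add: QG flip: R.A_vec R'.A_vec\<close>)
  have G': "G \<in> carrier_mat M M" and H': "H \<in> carrier_mat M M" using G H MM by auto
  show ?thesis
  proof (rule that[OF MM G' H'])
    show "G * H = 1\<^sub>m M" "H * G = 1\<^sub>m M" using inv MM by auto
    note T = R.T_carrier
    have GT: "G * T \<in> carrier_mat M M" using G' T by simp
    show "T' = G * T * H"
    proof (rule mat_eq_vecI[of _ M M])
      fix w :: "complex vec" assume w: "w \<in> carrier_vec M"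
      then have "T' *\<^sub>v w = T' *\<^sub>v (G *\<^sub>v (H *\<^sub>v w))" using GH MM by simp
      also have "\<dots> = G *\<^sub>v (T *\<^sub>v (H *\<^sub>v w))" using w MM by (intro TG) simp
      also have "\<dots> = (G * T * H) *\<^sub>v w"
        using assoc_mult_mat_vec[OF GT H' w] assoc_mult_mat_vec[OF G' T, of "H *\<^sub>v w"] w MM by simp
      finally show "T' *\<^sub>v w = (G * T * H) *\<^sub>v w" .
    qed (use R'.T_carrier MM GT H' in auto)
    show "Q' = Q * H"
    proof (rule mat_eq_vecI[of _ "eq_size e" M])
      fix w :: "complex vec" assume w: "w \<in> carrier_vec M"
      then have "Q' *\<^sub>v w = Q' *\<^sub>v (G *\<^sub>v (H *\<^sub>v w))" using GH MM by simp
      also have "\<dots> = Q *\<^sub>v (H *\<^sub>v w)" using w MM by (intro QG') simp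
      also have "\<dots> = (Q * H) *\<^sub>v w" using assoc_mult_mat_vec[OF R.Q_carrier H' w] by simp
      finally show "Q' *\<^sub>v w = (Q * H) *\<^sub>v w" .
    qed (use R'.Q_carrier R.Q_carrier MM H' in auto)
    show "P' = G * P"
      using R'.P_carrier R.P_carrier MM G' PG
      by (intro mat_eq_vecI[of _ M "eq_size e"]) (auto simp: assoc_mult_mat_vec[OF G' R.P_carrier])
  qed
qed

section \<open>Duality of minimal factorizations\<close>

context realization
begin

text \<open>Every residue factors through \<open>P\<close>, so an eigenvector killed by
  \<open>P\<close> lies in the kernel of all residues.\<close>

lemma P_inj:
  assumes "irreducible_eq e" "\<not> exceptional e"
    and v: "v \<in> carrier_vec N" "S *\<^sub>v v = \<alpha> \<cdot>\<^sub>v v" and P0: "P *\<^sub>v v = 0\<^sub>v M"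
  shows "v = 0\<^sub>v N"
proof (rule eigenvector_common_kernel[OF adm assms(1,2) v])
  fix k assume k: "k < q"
  show "A k *\<^sub>v v = 0\<^sub>v N"
    using k by (simp add: A_vec v P0 vlinear_zero[OF T.lin_E] vlinear_zero[OF lin_Q])
qed

text \<open>The vectors whose \<alpha>-component is reached by \<open>Q\<close> form an invariant
  subspace: \<open>S\<close> multiplies that component by \<alpha>, and each residue maps the whole
  space into the range of \<open>Q\<close>. Irreducibility leaves two cases, and the trivial one is
  excluded for nonzero \<open>v\<close> by \<open>eigenvector_common_kernel\<close>.\<close>

lemma Q_surj:
  assumes irr: "irreducible_eq e" and nexc: "\<not> exceptional e"
    and \<alpha>: "\<alpha> \<in> spec" and v: "v \<in> carrier_vec N" and eig: "S *\<^sub>v v = \<alpha> \<cdot>\<^sub>v v"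
  shows "\<exists>w\<in>carrier_vec M. v = E \<alpha> *\<^sub>v (Q *\<^sub>v w)"
proof -
  have Ev: "E \<alpha> *\<^sub>v v = v" using S.E_eigenvector(2)[OF v eig \<alpha>] by simp
  define X where "X = {u \<in> carrier_vec N. \<exists>w\<in>carrier_vec M. E \<alpha> *\<^sub>v u = E \<alpha> *\<^sub>v (Q *\<^sub>v w)}"
  have AX: "A k *\<^sub>v u \<in> X" if "k < q" "u \<in> carrier_vec N" for k u
    using that unfolding X_def by (auto simp: A_vec intro!: bexI[of _ "F k *\<^sub>v (P *\<^sub>v u)"])
  have X: "vsubspace N X"
  proof (rule vsubspaceI)
    show "0\<^sub>v N \<in> X"
      unfolding X_def using vlinear_zero[OF lin_Q] by (auto intro!: bexI[of _ "0\<^sub>v M"])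
    fix u u' assume u: "u \<in> X" and u': "u' \<in> X"
    obtain w where w: "w \<in> carrier_vec M" "E \<alpha> *\<^sub>v u = E \<alpha> *\<^sub>v (Q *\<^sub>v w)"
      using u unfolding X_def by blast
    obtain w' where w': "w' \<in> carrier_vec M" "E \<alpha> *\<^sub>v u' = E \<alpha> *\<^sub>v (Q *\<^sub>v w')"
      using u' unfolding X_def by blast
    have "E \<alpha> *\<^sub>v (u + u') = E \<alpha> *\<^sub>v (Q *\<^sub>v (w + w'))"
      using w w' u u' by (simp add: X_def vlinearD(2)[OF S.lin_E[OF \<alpha>]] vlinearD(2)[OF lin_Q])
    then show "u + u' \<in> X"
      using u u' w(1) w'(1) unfolding X_def by (auto intro!: bexI[of _ "w + w'"])
  next
    fix c u assume u: "u \<in> X"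
    obtain w where w: "w \<in> carrier_vec M" "E \<alpha> *\<^sub>v u = E \<alpha> *\<^sub>v (Q *\<^sub>v w)"
      using u unfolding X_def by blast
    have "E \<alpha> *\<^sub>v (c \<cdot>\<^sub>v u) = E \<alpha> *\<^sub>v (Q *\<^sub>v (c \<cdot>\<^sub>v w))"
      using w u by (simp add: X_def vlinearD(3)[OF S.lin_E[OF \<alpha>]] vlinearD(3)[OF lin_Q])
    then show "c \<cdot>\<^sub>v u \<in> X"
      using u w(1) unfolding X_def by (auto intro!: bexI[of _ "c \<cdot>\<^sub>v w"])
  qed (auto simp: X_def)
  have "X = {0\<^sub>v N} \<or> X = carrier_vec N"
  proof (rule irreducible_eqD[OF adm irr X])
    fix u assume u: "u \<in> X"
    obtain w where w: "w \<in> carrier_vec M" "E \<alpha> *\<^sub>v u = E \<alpha> *\<^sub>v (Q *\<^sub>v w)"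
      using u unfolding X_def by blast
    have "E \<alpha> *\<^sub>v (S *\<^sub>v u) = E \<alpha> *\<^sub>v (Q *\<^sub>v (\<alpha> \<cdot>\<^sub>v w))"
      using w u S.E_S[OF \<alpha>] 
      by (simp add: X_def vlinearD(3)[OF S.lin_E[OF \<alpha>]] vlinearD(3)[OF lin_Q])
    then show "S *\<^sub>v u \<in> X"
      using u w(1) unfolding X_def by (auto intro!: bexI[of _ "\<alpha> \<cdot>\<^sub>v w"])
  next
    show "A k *\<^sub>v u \<in> X" if "k < q" "u \<in> X" for k u
      using AX[OF that(1)] vsubspaceD(1)[OF X that(2)] by simp
  qed
  then show ?thesis
  proof
    \<comment> \<open>The images of all residues lie in \<open>X\<close>, so now all residues vanish
      on \<open>v\<close>.\<close>
    assume "X = {0\<^sub>v N}"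
    then have "A k *\<^sub>v v = 0\<^sub>v N" if "k < q" for k using AX[OF that v] by simp
    then have "v = 0\<^sub>v N" by (rule eigenvector_common_kernel[OF adm irr nexc v eig])
    then show ?thesis
      using vlinear_zero[OF lin_Q] vlinear_zero[OF S.lin_E[OF \<alpha>]] by (auto intro!: bexI[of _ "0\<^sub>v M"])
  next
    assume "X = carrier_vec N"
    then have "v \<in> X" using v by simp
    then show ?thesis unfolding X_def using Ev by auto
  qed
qed

text \<open>Otherwise \<open>P\<close> would kill every eigenvector, since each is an
  \<alpha>-component of a vector in the range of \<open>Q\<close>; then all eigenvectors would
  vanish by \<open>P_inj\<close>, although the size is at least 1. This single fact makes the
  transformed equation have positive size and a nonzero residue.\<close>

lemma ex_P_E_Q_nonzero:
  assumes irr: "irreducible_eq e" and nexc: "\<not> exceptional e"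
  shows "\<exists>\<alpha>\<in>spec. \<exists>w\<in>carrier_vec M. P *\<^sub>v (E \<alpha> *\<^sub>v (Q *\<^sub>v w)) \<noteq> 0\<^sub>v M"
proof (rule ccontr)
  assume neg: "\<not> ?thesis"
  define v :: "complex vec" where "v = unit_vec N 0"
  have v: "v \<in> carrier_vec N" by (simp add: v_def)
  have "E \<alpha> *\<^sub>v v = 0\<^sub>v N" if \<alpha>: "\<alpha> \<in> spec" for \<alpha>
  proof (rule P_inj[OF irr nexc])
    show "E \<alpha> *\<^sub>v v \<in> carrier_vec N" "S *\<^sub>v (E \<alpha> *\<^sub>v v) = \<alpha> \<cdot>\<^sub>v (E \<alpha> *\<^sub>v v)"
      using S.E_vec[OF \<alpha> v] S.S_E[OF \<alpha> v] by auto
    then obtain w where "w \<in> carrier_vec M" "E \<alpha> *\<^sub>v v = E \<alpha> *\<^sub>v (Q *\<^sub>v w)"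
      using Q_surj[OF irr nexc \<alpha>] by blast
    then show "P *\<^sub>v (E \<alpha> *\<^sub>v v) = 0\<^sub>v M" using neg \<alpha> by auto
  qed
  then have "vsum N (\<lambda>\<alpha>. E \<alpha> *\<^sub>v v) spec = vsum N (\<lambda>\<alpha>. 0\<^sub>v N) spec" by (intro vsum_cong) simp
  also have "\<dots> = 0\<^sub>v N" by (intro eq_vecI) (auto simp: vsum_def)
  finally have "v = 0\<^sub>v N" using S.sum_E[OF v] by simp
  then have "v $ 0 = (0\<^sub>v N :: complex vec) $ 0" by simp
  then show False using admissibleD(1)[OF adm] by (simp add: v_def)
qed

end

text \<open>The result of a transform written through a minimal factorization of the source. The
  factors \<open>c\<close> and \<open>s\<close> cover both transforms: \<open>c = -1\<close>,
  \<open>s = 1\<close> for the middle Laplace transform and \<open>c = 1\<close>,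
  \<open>s = -1\<close> for its inverse.\<close>

locale dual_realization = realization +
  fixes c s :: complex and \<alpha>s :: "complex list" and e' :: equation
  assumes irr: "irreducible_eq e" and nexc: "\<not> exceptional e"
    and nonzero: "c \<noteq> 0" "s \<noteq> 0"
    and eigenvalues: "distinct \<alpha>s" "set \<alpha>s = spec"
    and dual_lead: "lead_mat e' = c \<cdot>\<^sub>m T"
    and dual_pts: "sing_pts e' = map ((*) s) \<alpha>s"
    and dual_length: "length (res_mats e') = length \<alpha>s"
    and dual_res: "j < length \<alpha>s \<Longrightarrow> res_mats e' ! j = - (P * (E (\<alpha>s ! j) * Q))"
begin

lemma dual_size: "eq_size e' = M"
  using dual_lead T_carrier by (auto simp: eq_size_def)

lemma dual_num_pts: "num_pts e' = length \<alpha>s"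
  by (simp add: num_pts_def dual_pts)

lemma nth_spec: "j < length \<alpha>s \<Longrightarrow> \<alpha>s ! j \<in> spec"
  using eigenvalues(2) nth_mem by blast

lemma PEQ_vec:
  assumes "\<alpha> \<in> spec" "w \<in> carrier_vec M"
  shows "- (P * (E \<alpha> * Q)) *\<^sub>v w = - (P *\<^sub>v (E \<alpha> *\<^sub>v (Q *\<^sub>v w)))"
proof -
  note EQ = mult_carrier_mat[OF S.E_carrier[OF assms(1)] Q_carrier]
  have "(P * (E \<alpha> * Q)) *\<^sub>v w = P *\<^sub>v (E \<alpha> *\<^sub>v (Q *\<^sub>v w))"
    using assoc_mult_mat_vec[OF P_carrier EQ assms(2)]
      assoc_mult_mat_vec[OF S.E_carrier[OF assms(1)] Q_carrier assms(2)] by simp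
  moreover have "dim_vec w = dim_col (P * (E \<alpha> * Q))"
    using assms(2) Q_carrier by simp
  ultimately show ?thesis by simp
qed

text \<open>The delicate point is positive size: in size zero every vector is zero, against
  \<open>ex_P_E_Q_nonzero\<close>. Nonzero \<open>c\<close> preserves diagonalizability, and nonzero
  \<open>s\<close> keeps the singular points distinct.\<close>

lemma dual_admissible: "admissible e'"
proof -
  have "M \<noteq> 0"
  proof
    assume M: "M = 0"
    obtain \<alpha> w where aw: "\<alpha> \<in> spec" "w \<in> carrier_vec M" "P *\<^sub>v (E \<alpha> *\<^sub>v (Q *\<^sub>v w)) \<noteq> 0\<^sub>v M"
      using ex_P_E_Q_nonzero[OF irr nexc] by blast
    have "P *\<^sub>v (E \<alpha> *\<^sub>v (Q *\<^sub>v w)) \<in> carrier_vec M"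
      by (rule P_vec[OF S.E_vec[OF aw(1) Q_vec[OF aw(2)]]])
    then have "dim_vec (P *\<^sub>v (E \<alpha> *\<^sub>v (Q *\<^sub>v w))) = 0" unfolding M by (rule carrier_vecD)
    then have "P *\<^sub>v (E \<alpha> *\<^sub>v (Q *\<^sub>v w)) = 0\<^sub>v M" unfolding M by (intro eq_vecI) simp_all
    then show False using aw(3) by contradiction
  qed
  moreover have "diagonalizable_mat (c \<cdot>\<^sub>m T)"
    using spectral_resolution.diagonalizable[OF T.scaled[OF nonzero(1)]] .
  moreover have "B \<in> carrier_mat M M" if "B \<in> set (res_mats e')" for B
  proof -
    obtain j where j: "j < length \<alpha>s" "B = res_mats e' ! j"
      using dual_length \<open>B \<in> set (res_mats e')\<close> by (metis in_set_conv_nth)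
    then show ?thesis
      using mult_carrier_mat[OF P_carrier mult_carrier_mat[OF S.E_carrier[OF nth_spec] Q_carrier]]
      by (simp add: dual_res)
  qed
  moreover have "distinct (sing_pts e')"
    using eigenvalues(1) dual_pts nonzero(2) by (auto simp: distinct_map inj_on_def)
  ultimately show ?thesis
    using dual_lead dual_num_pts dual_length T_carrier by (auto simp: admissible_def dual_size)
qed

lemma dual_not_exceptional: "\<not> exceptional e'"
proof
  assume exc: "exceptional e'"
  obtain \<alpha> w where aw: "\<alpha> \<in> spec" "w \<in> carrier_vec M" "P *\<^sub>v (E \<alpha> *\<^sub>v (Q *\<^sub>v w)) \<noteq> 0\<^sub>v M"
    using ex_P_E_Q_nonzero[OF irr nexc] by blast
  obtain j where j: "j < length \<alpha>s" "\<alpha>s ! j = \<alpha>" using aw(1) eigenvalues(2) by (metis in_set_conv_nth)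
  have "\<forall>B\<in>set (res_mats e'). B = 0\<^sub>m M M"
    using exc by (auto simp: exceptional_def dual_size)
  then have "res_mats e' ! j = 0\<^sub>m M M"
    using j(1) dual_length nth_mem[of j "res_mats e'"] by metis
  then have "- (P *\<^sub>v (E \<alpha> *\<^sub>v (Q *\<^sub>v w))) = 0\<^sub>m M M *\<^sub>v w"
    using dual_res[OF j(1)] PEQ_vec[OF aw(1,2)] j(2) by simp
  also have "\<dots> = 0\<^sub>v M" using aw(2) by (intro eq_vecI) auto
  finally have "- (- (P *\<^sub>v (E \<alpha> *\<^sub>v (Q *\<^sub>v w)))) = - 0\<^sub>v M" by simp
  then show False using aw(3) by simp
qed

text \<open>An invariant subspace \<open>U\<close> of the dual is pulled back to an invariant
  subspace \<open>X\<close> of the original equation. If \<open>X\<close> is zero, then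
  \<open>Q\<close> kills all spectral components of \<open>U\<close>, so \<open>U\<close> is zero by
  observability. If \<open>X\<close> is everything, then \<open>U\<close> contains the range of
  \<open>P\<close>, hence its spectral components, and these generate the state space.\<close>

lemma dual_irreducible: "irreducible_eq e'"
proof (rule irreducible_eqI[OF dual_admissible], unfold dual_size)
  fix U assume U: "vsubspace M U" and lead: "\<And>w. w \<in> U \<Longrightarrow> lead_mat e' *\<^sub>v w \<in> U"
    and res: "\<And>k w. k < num_pts e' \<Longrightarrow> w \<in> U \<Longrightarrow> res_mats e' ! k *\<^sub>v w \<in> U"
  note UM = vsubspaceD(1)[OF U]
  have TU: "T *\<^sub>v w \<in> U" if w: "w \<in> U" for w
  proof -
    have "(1 / c) \<cdot>\<^sub>v (lead_mat e' *\<^sub>v w) = T *\<^sub>v w"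
      using nonzero(1) smult_mat_mult_vec[OF T_carrier UM[OF w], of c] dual_lead
      by (simp add: smult_smult_assoc)
    then show ?thesis using vsubspaceD(4)[OF U lead[OF w]] by metis
  qed
  have FU: "F k *\<^sub>v w \<in> U" if "k < q" "w \<in> U" for k w
    using T.E_invariant_subspace[OF U TU that(2)] that(1) by simp
  have PEQ_U: "P *\<^sub>v (E \<alpha> *\<^sub>v (Q *\<^sub>v w)) \<in> U" if \<alpha>: "\<alpha> \<in> spec" and w: "w \<in> U" for \<alpha> w
  proof -
    obtain j where j: "j < length \<alpha>s" "\<alpha>s ! j = \<alpha>" using \<alpha> eigenvalues(2) by (metis in_set_conv_nth)
    have "(-1) \<cdot>\<^sub>v (res_mats e' ! j *\<^sub>v w) = P *\<^sub>v (E \<alpha> *\<^sub>v (Q *\<^sub>v w))"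
      using dual_res[OF j(1)] j(2) PEQ_vec[OF \<alpha> UM[OF w]]
      by (intro eq_vecI) (auto simp del: index_mult_mat_vec)
    then show ?thesis using vsubspaceD(4)[OF U res[OF _ w]] j(1) dual_num_pts by metis
  qed
  \<comment> \<open>Asking for each component separately makes \<open>X\<close> stable under
    \<open>S\<close>. Invariance of \<open>U\<close> under the dual residues says that
    \<open>Q\<close> maps \<open>U\<close> into \<open>X\<close>, while summing the components shows
    that \<open>P\<close> maps \<open>X\<close> into \<open>U\<close>; together they make
    \<open>X\<close> stable under the residues.\<close>
  define X where "X = {v \<in> carrier_vec N. \<forall>\<alpha>\<in>spec. P *\<^sub>v (E \<alpha> *\<^sub>v v) \<in> U}"
  have PX: "P *\<^sub>v v \<in> U" if v: "v \<in> X" for v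
  proof -
    have vN: "v \<in> carrier_vec N" using v by (simp add: X_def)
    have "P *\<^sub>v v = P *\<^sub>v vsum N (\<lambda>\<alpha>. E \<alpha> *\<^sub>v v) spec" using S.sum_E[OF vN] by simp
    also have "\<dots> = vsum M (\<lambda>\<alpha>. P *\<^sub>v (E \<alpha> *\<^sub>v v)) spec"
      using S.E_vec vN by (intro vlinear_vsum[OF lin_P S.finite_I])
    also have "\<dots> \<in> U" using v by (intro vsum_in_subspace[OF U]) (simp add: X_def)
    finally show ?thesis .
  qed
  have QX: "Q *\<^sub>v w \<in> X" if "w \<in> U" for w
    using PEQ_U that UM[OF that] by (simp add: X_def)
  have X: "vsubspace N X"
  proof (rule vsubspaceI)
    show "0\<^sub>v N \<in> X" using vsubspaceD(2)[OF U]
      by (simp add: X_def vlinear_zero[OF S.lin_E] vlinear_zero[OF lin_P])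
    show "u + v \<in> X" if "u \<in> X" "v \<in> X" for u v
      using that vsubspaceD(3)[OF U]
      by (simp add: X_def vlinearD(2)[OF S.lin_E] vlinearD(2)[OF lin_P])
    show "k \<cdot>\<^sub>v v \<in> X" if "v \<in> X" for k v
      using that vsubspaceD(4)[OF U]
      by (simp add: X_def vlinearD(3)[OF S.lin_E] vlinearD(3)[OF lin_P])
  qed (auto simp: X_def)
  have "X = {0\<^sub>v N} \<or> X = carrier_vec N"
  proof (rule irreducible_eqD[OF adm irr X])
    show "S *\<^sub>v v \<in> X" if "v \<in> X" for v
      using that vsubspaceD(4)[OF U]
      by (simp add: X_def S.E_S vlinearD(3)[OF lin_P])
    show "A k *\<^sub>v v \<in> X" if "k < q" "v \<in> X" for k v
      using QX[OF FU[OF that(1) PX[OF that(2)]]] A_vec[OF that(1) vsubspaceD(1)[OF X that(2)]] by simp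
  qed
  then show "U = {0\<^sub>v M} \<or> U = carrier_vec M"
  proof
    assume X0: "X = {0\<^sub>v N}"
    have "u = 0\<^sub>v M" if u: "u \<in> U" for u
    proof (rule eq_if_Q_F_eq)
      fix k assume k: "k < q"
      have "Q *\<^sub>v (F k *\<^sub>v u) = 0\<^sub>v N" using QX[OF FU[OF k u]] X0 by simp
      then show "Q *\<^sub>v (F k *\<^sub>v u) = Q *\<^sub>v (F k *\<^sub>v 0\<^sub>v M)"
        using k by (simp add: vlinear_zero[OF T.lin_E] vlinear_zero[OF lin_Q])
    qed (use UM[OF u] in auto)
    then have "U = {0\<^sub>v M}" using vsubspaceD(2)[OF U] by blast
    then show ?thesis ..
  next
    assume XN: "X = carrier_vec N"
    have "w \<in> U" if w: "w \<in> carrier_vec M" for w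
    proof -
      have "F k *\<^sub>v w \<in> U" if k: "k < q" for k
      proof -
        obtain v where "v \<in> carrier_vec N" "F k *\<^sub>v w = F k *\<^sub>v (P *\<^sub>v v)"
          using F_eq_F_P[OF k w] by blast
        then show ?thesis using FU[OF k PX] XN by simp
      qed
      then have "vsum M (\<lambda>k. F k *\<^sub>v w) {..<q} \<in> U" by (intro vsum_in_subspace[OF U]) simp
      then show ?thesis using T.sum_E[OF w] by simp
    qed
    then have "U = carrier_vec M" using UM by blast
    then show ?thesis ..
  qed
qed

text \<open>The roles are exchanged: \<open>P_inj\<close> is the condition on the new left factor
  \<open>- P\<close>, and \<open>Q_surj\<close> the one on the new right factor \<open>Q\<close>.
  The minus sign of the dual residues is put into the left factor.\<close>

lemma realization_dual: "realization e' N (s \<cdot>\<^sub>m S) (- P) Q"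
proof -
  note sc = S.scaled[OF nonzero(2)]
  have eq: "eigenproj (s \<cdot>\<^sub>m S) (s * \<alpha>) = E \<alpha>" if "\<alpha> \<in> spec" for \<alpha>
    using spectral_resolution.eigenproj_eq[OF sc that] by simp
  have eig: "S *\<^sub>v v = \<alpha> \<cdot>\<^sub>v v" if v: "v \<in> carrier_vec N" and sv: "(s \<cdot>\<^sub>m S) *\<^sub>v v = (s * \<alpha>) \<cdot>\<^sub>v v" for v \<alpha>
  proof -
    have "(1 / s) \<cdot>\<^sub>v ((s \<cdot>\<^sub>m S) *\<^sub>v v) = (1 / s) \<cdot>\<^sub>v ((s * \<alpha>) \<cdot>\<^sub>v v)" using sv by simp
    then show ?thesis
      using nonzero(2) smult_mat_mult_vec[OF S.S_carrier v] by (simp add: smult_smult_assoc)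
  qed
  show ?thesis
  proof
    show "admissible e'" by (rule dual_admissible)
    show "s \<cdot>\<^sub>m S \<in> carrier_mat N N" using S.S_carrier by simp
    show "diagonalizable_mat (s \<cdot>\<^sub>m S)" by (rule spectral_resolution.diagonalizable[OF sc])
    show "{\<alpha>. eigenvalue (s \<cdot>\<^sub>m S) \<alpha>} \<subseteq> set (sing_pts e')"
      using spectral_resolution.eigenvalue_in[OF sc] eigenvalues(2) dual_pts by auto
    show "- P \<in> carrier_mat (eq_size e') N" "Q \<in> carrier_mat N (eq_size e')"
      using P_carrier Q_carrier dual_size by auto
  next
    fix k assume "k < num_pts e'"
    then have k: "k < length \<alpha>s" using dual_num_pts by simp
    have EQ: "E (\<alpha>s ! k) * Q \<in> carrier_mat N M"
      using S.E_carrier[OF nth_spec[OF k]] Q_carrier by simp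
    have a: "sing_pts e' ! k = s * \<alpha>s ! k" using dual_pts k by simp
    have "dim_col P = dim_row (E (\<alpha>s ! k) * Q)" using EQ P_carrier by auto
    then show "res_mats e' ! k = - P * (eigenproj (s \<cdot>\<^sub>m S) (sing_pts e' ! k) * Q)"
      unfolding a using eq[OF nth_spec[OF k]] dual_res[OF k] by simp
    fix v assume v: "v \<in> carrier_vec N" and sv: "(s \<cdot>\<^sub>m S) *\<^sub>v v = sing_pts e' ! k \<cdot>\<^sub>v v"
    have Sv: "S *\<^sub>v v = \<alpha>s ! k \<cdot>\<^sub>v v" using eig[OF v] sv a by simp
    show "\<exists>w\<in>carrier_vec (eq_size e'). v = eigenproj (s \<cdot>\<^sub>m S) (sing_pts e' ! k) *\<^sub>v (Q *\<^sub>v w)"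
      using Q_surj[OF irr nexc nth_spec[OF k] v Sv] eq[OF nth_spec[OF k]] a dual_size by simp
    assume "- P *\<^sub>v v = 0\<^sub>v (eq_size e')"
    then have "- (- (P *\<^sub>v v)) = - 0\<^sub>v M" using P_carrier v dual_size by simp
    then have "P *\<^sub>v v = 0\<^sub>v M" by simp
    then show "v = 0\<^sub>v N" using P_inj[OF irr nexc v Sv] by simp
  qed
qed

end

section \<open>The factorization on the quotient space\<close>

lemma block_carrier [simp]: "block N v k \<in> carrier_vec N"
  by (simp add: block_def)

lemma tuple_carrier [simp]: "tuple q N f \<in> carrier_vec (q * N)"
  by (simp add: tuple_def)

lemma block_index_less:
  assumes "k < q" "r < N"
  shows "k * N + r < q * (N :: nat)"
proof -
  have "k * N + r < Suc k * N" using assms(2) by simp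
  also have "\<dots> \<le> q * N" using assms(1) by (intro mult_le_mono1) simp
  finally show ?thesis .
qed

lemma block_tuple:
  assumes "k < q" "f k \<in> carrier_vec N"
  shows "block N (tuple q N f) k = f k"
  using assms block_index_less[OF assms(1)] by (intro eq_vecI) (auto simp: block_def tuple_def)

lemma tuple_cong: 
  assumes "\<And>k. k < q \<Longrightarrow> f k = g k"
  shows "tuple q N f = tuple q N g"
proof -
  have "f (i div N) = g (i div N)" if "i < q * N" for i
    using assms[of "i div N"] that by (simp add: less_mult_imp_div_less)
  then show ?thesis by (intro eq_vecI) (auto simp: tuple_def)
qed

lemma tuple_block:
  assumes "v \<in> carrier_vec (q * N)"
  shows "tuple q N (block N v) = v"
proof (rule eq_vecI)
  fix i assume "i < dim_vec v"
  then have i: "i < q * N" using assms by simp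
  then have "0 < N" by (cases N) auto
  then show "tuple q N (block N v) $ i = v $ i" using i by (simp add: tuple_def block_def)
qed (use assms in \<open>simp add: tuple_def\<close>)

text \<open>Identities between concatenated vectors are proved block by block with this rule, which
  keeps the index arithmetic of the encoding out of the later arguments.\<close>

lemma block_eqI:
  assumes "u \<in> carrier_vec (q * N)" "v \<in> carrier_vec (q * N)"
    "\<And>k. k < q \<Longrightarrow> block N u k = block N v k"
  shows "u = v"
  using tuple_cong[of q "block N u" "block N v" N, OF assms(3)] tuple_block assms(1,2) by simp

lemma vlinear_block:
  assumes "k < q"
  shows "vlinear (q * N) N (\<lambda>v. block N v k)"
  using block_index_less[OF assms] by (intro vlinearI eq_vecI) (auto simp: block_def)

lemma block_zero: "k < q \<Longrightarrow> block N (0\<^sub>v (q * N)) k = 0\<^sub>v N"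
  using vlinear_zero[OF vlinear_block] by blast

lemma vlinear_cong:
  assumes "vlinear n m f" "\<And>v. v \<in> carrier_vec n \<Longrightarrow> f v = g v"
  shows "vlinear n m g"
  by (rule vlinearI) (simp_all add: vlinearD[OF assms(1)] flip: assms(2))

lemma vlinear_tuple:
  assumes f: "\<And>k. k < q \<Longrightarrow> vlinear n N (f k)"
  shows "vlinear n (q * N) (\<lambda>v. tuple q N (\<lambda>k. f k v))"
proof (rule vlinearI)
  note D = vlinearD[OF f]
  note b = vlinearD[OF vlinear_block]
  show "tuple q N (\<lambda>k. f k (u + v)) = tuple q N (\<lambda>k. f k u) + tuple q N (\<lambda>k. f k v)"
    if "u \<in> carrier_vec n" "v \<in> carrier_vec n" for u v
    by (rule block_eqI[of _ q N]) (use that in \<open>simp_all add: b block_tuple D\<close>)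
  show "tuple q N (\<lambda>k. f k (c \<cdot>\<^sub>v v)) = c \<cdot>\<^sub>v tuple q N (\<lambda>k. f k v)"
    if "v \<in> carrier_vec n" for c v
    by (rule block_eqI[of _ q N]) (use that in \<open>simp_all add: b block_tuple D\<close>)
qed simp

lemma vlinear_id: "vlinear n n (\<lambda>v. v)"
  by (rule vlinearI) auto

lemma vlinear_const_zero: "vlinear n m (\<lambda>v. 0\<^sub>v m)"
  by (rule vlinearI) (auto simp: smult_zero_vec_carrier)

lemma vlinear_smult: "vlinear n m f \<Longrightarrow> vlinear n m (\<lambda>v. c \<cdot>\<^sub>v f v)"
  using vlinear_comp[of n m f m "(\<cdot>\<^sub>v) c"]
  by (simp add: vlinear_def smult_add_distrib_vec[of _ m] smult_smult_assoc mult.commute)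

lemma vlinear_sum:
  assumes f: "\<And>k. k \<in> I \<Longrightarrow> vlinear n m (f k)"
  shows "vlinear n m (\<lambda>v. vsum m (\<lambda>k. f k v) I)"
proof (rule vlinearI)
  note D = vlinearD[OF f]
  show "vsum m (\<lambda>k. f k (u + v)) I = vsum m (\<lambda>k. f k u) I + vsum m (\<lambda>k. f k v) I"
    if "u \<in> carrier_vec n" "v \<in> carrier_vec n" for u v
  proof -
    have "vsum m (\<lambda>k. f k (u + v)) I = vsum m (\<lambda>k. f k u + f k v) I"
      by (rule vsum_cong) (simp add: D(2) that)
    then show ?thesis by (simp add: vsum_add D(1) that)
  qed
  show "vsum m (\<lambda>k. f k (c \<cdot>\<^sub>v v)) I = c \<cdot>\<^sub>v vsum m (\<lambda>k. f k v) I"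
    if "v \<in> carrier_vec n" for c v
  proof -
    have "vsum m (\<lambda>k. f k (c \<cdot>\<^sub>v v)) I = vsum m (\<lambda>k. c \<cdot>\<^sub>v f k v) I"
      by (rule vsum_cong) (simp add: D(3) that)
    then show ?thesis by (simp add: vsum_smult D(1) that)
  qed
qed simp

lemma K_space_iff:
  assumes "admissible e"
  shows "v \<in> K_space e \<longleftrightarrow> v \<in> carrier_vec (num_pts e * eq_size e) \<and>
    (\<forall>k<num_pts e. res_mats e ! k *\<^sub>v block (eq_size e) v k = 0\<^sub>v (eq_size e))"
proof -
  have "block (eq_size e) v k \<in> mat_kernel (res_mats e ! k) \<longleftrightarrow>
    res_mats e ! k *\<^sub>v block (eq_size e) v k = 0\<^sub>v (eq_size e)" if "k < num_pts e" for k
    using admissibleD(5)[OF assms that] by (auto simp: mat_kernel_def)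
  then show ?thesis by (auto simp: K_space_def)
qed

lemma vsubspace_K_space:
  assumes "admissible e"
  shows "vsubspace (num_pts e * eq_size e) (K_space e)"
proof (rule vsubspaceI)
  note A = vlinear_mat[OF admissibleD(5)[OF assms]]
  note b = vlinearD[OF vlinear_block]
  show "0\<^sub>v (num_pts e * eq_size e) \<in> K_space e"
    by (simp add: K_space_iff[OF assms] block_zero vlinear_zero[OF A])
  show "u + v \<in> K_space e" if "u \<in> K_space e" "v \<in> K_space e" for u v
    using that by (simp add: K_space_iff[OF assms] b vlinearD(2)[OF A])
  show "c \<cdot>\<^sub>v v \<in> K_space e" if "v \<in> K_space e" for c v
    using that by (simp add: K_space_iff[OF assms] b vlinearD(3)[OF A] smult_zero_vec_carrier)
qed (auto simp: K_space_iff[OF assms])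

text \<open>The selection is run on the unit vectors. Independence of the chosen vectors modulo
  \<open>K\<close> gives uniqueness of coordinates, and spanning extends from unit vectors to all
  vectors by linearity.\<close>

lemma ex_quotient_basis:
  assumes K: "vsubspace n K"
  shows "\<exists>m R. quotient_basis n K m R"
proof -
  have units: "set (map (unit_vec n :: nat \<Rightarrow> complex vec) [0..<n]) \<subseteq> carrier_vec n" by auto
  obtain bs where bs: "set bs \<subseteq> set (map (unit_vec n) [0..<n])"
    and inj: "\<And>c. c \<in> carrier_vec (length bs) \<Longrightarrow> mat_of_cols n bs *\<^sub>v c \<in> K \<Longrightarrow> c = 0\<^sub>v (length bs)"
    and sp: "\<And>x. x \<in> set (map (unit_vec n) [0..<n]) \<Longrightarrow>
      \<exists>c\<in>carrier_vec (length bs). x - mat_of_cols n bs *\<^sub>v c \<in> K"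
    using basis_selection_mod_subspace[OF K units] by blast
  define m where "m = length bs"
  define R where "R = mat_of_cols n bs"
  have R: "R \<in> carrier_mat n m" by (simp add: R_def m_def)
  note lin_R = vlinear_mat[OF R]
  note KD = vsubspaceD[OF K]
  define X where "X = {v \<in> carrier_vec n. \<exists>c\<in>carrier_vec m. v - R *\<^sub>v c \<in> K}"
  have X: "vsubspace n X"
  proof (rule vsubspaceI)
    show "0\<^sub>v n \<in> X"
      unfolding X_def using vlinear_zero[OF lin_R] KD(2) by (auto intro!: bexI[of _ "0\<^sub>v m"])
    fix u v assume u: "u \<in> X" and v: "v \<in> X"
    obtain c where c: "c \<in> carrier_vec m" "u - R *\<^sub>v c \<in> K" using u unfolding X_def by blast
    obtain d where d: "d \<in> carrier_vec m" "v - R *\<^sub>v d \<in> K" using v unfolding X_def by blast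
    have uv: "u \<in> carrier_vec n" "v \<in> carrier_vec n" using u v by (auto simp: X_def)
    have "(u + v) - R *\<^sub>v (c + d) = (u - R *\<^sub>v c) + (v - R *\<^sub>v d)"
      unfolding vlinearD(2)[OF lin_R c(1) d(1)] using R uv
      by (intro eq_vecI) (auto simp del: index_mult_mat_vec simp: carrier_vecD)
    then have "(u + v) - R *\<^sub>v (c + d) \<in> K" using KD(3) c d by simp
    then show "u + v \<in> X" using uv c(1) d(1) unfolding X_def by auto
  next
    fix k v assume v: "v \<in> X"
    obtain d where d: "d \<in> carrier_vec m" "v - R *\<^sub>v d \<in> K" using v unfolding X_def by blast
    have vn: "v \<in> carrier_vec n" using v by (auto simp: X_def)
    have "k \<cdot>\<^sub>v v - R *\<^sub>v (k \<cdot>\<^sub>v d) = k \<cdot>\<^sub>v (v - R *\<^sub>v d)"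
      unfolding vlinearD(3)[OF lin_R d(1)] using R vn
      by (intro eq_vecI) (auto simp del: index_mult_mat_vec simp: carrier_vecD algebra_simps)
    then have "k \<cdot>\<^sub>v v - R *\<^sub>v (k \<cdot>\<^sub>v d) \<in> K" using KD(4) d by simp
    then show "k \<cdot>\<^sub>v v \<in> X" using vn d(1) unfolding X_def by auto
  qed (auto simp: X_def)
  have ex: "\<exists>c\<in>carrier_vec m. v - R *\<^sub>v c \<in> K" if v: "v \<in> carrier_vec n" for v
  proof -
    have "unit_vec n j \<in> X" if "j < n" for j
      using sp[of "unit_vec n j"] that by (auto simp: X_def R_def m_def)
    then have "vsum n (\<lambda>j. v $ j \<cdot>\<^sub>v unit_vec n j) {..<n} \<in> X"
      by (intro vsum_in_subspace[OF X] vsubspaceD(4)[OF X]) simp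
    then show ?thesis unfolding unit_vecs_span[OF v] by (simp add: X_def)
  qed
  have "c = d" if v: "v \<in> carrier_vec n" and c: "c \<in> carrier_vec m" "v - R *\<^sub>v c \<in> K"
    and d: "d \<in> carrier_vec m" "v - R *\<^sub>v d \<in> K" for v c d
  proof -
    have "R *\<^sub>v (c - d) = (v - R *\<^sub>v d) - (v - R *\<^sub>v c)"
      unfolding vlinear_diff[OF lin_R c(1) d(1)] using R v
      by (intro eq_vecI) (auto simp del: index_mult_mat_vec)
    then have "R *\<^sub>v (c - d) \<in> K" using vsubspace_diff[OF K] c d by simp
    then have "c - d = 0\<^sub>v m" using inj[of "c - d"] c d by (simp add: R_def m_def)
    then show ?thesis using diff_eq_zero_vec_iff[OF c(1) d(1)] by simp
  qed
  then have "quotient_basis n K m R" unfolding quotient_basis_def using R ex by blast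
  then show ?thesis by blast
qed

text \<open>\<open>G\<close> is the coordinate map \<open>\<complex>\<^bsup>q N\<^esup> \<rightarrow> \<complex>\<^sup>m\<close> of the quotient basis \<open>R\<close>.\<close>

locale quotient_coordinates =
  fixes e :: equation and m :: nat and R G :: "complex mat"
  assumes adm: "admissible e"
    and R_carrier: "R \<in> carrier_mat (num_pts e * eq_size e) m"
    and G_carrier: "G \<in> carrier_mat m (num_pts e * eq_size e)"
    and G_iff: "v \<in> carrier_vec (num_pts e * eq_size e) \<Longrightarrow> c \<in> carrier_vec m \<Longrightarrow>
      v - R *\<^sub>v c \<in> K_space e \<longleftrightarrow> c = G *\<^sub>v v"

text \<open>The coordinates required by \<open>quotient_basis\<close> are unique, and the relation
  defining them is linear because \<open>K_space e\<close> is a subspace; hence they are given by a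
  matrix.\<close>

lemma quotient_basis_coordinates:
  assumes adm: "admissible e"
    and qb: "quotient_basis (num_pts e * eq_size e) (K_space e) m R"
  shows "\<exists>G. quotient_coordinates e m R G"
proof -
  define n where "n = num_pts e * eq_size e"
  note qb = qb[folded n_def]
  have K: "vsubspace n (K_space e)" using vsubspace_K_space[OF adm] by (simp add: n_def)
  note KD = vsubspaceD[OF K]
  have R: "R \<in> carrier_mat n m" using qb by (simp add: quotient_basis_def)
  have qb1: "\<exists>!c. c \<in> carrier_vec m \<and> v - R *\<^sub>v c \<in> K_space e" if "v \<in> carrier_vec n" for v
    using qb that by (simp add: quotient_basis_def)
  note lin_R = vlinear_mat[OF R]
  have add: "(u + v) - R *\<^sub>v (c + d) \<in> K_space e"
    if "u \<in> carrier_vec n" "v \<in> carrier_vec n" "c \<in> carrier_vec m" "d \<in> carrier_vec m"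
      "u - R *\<^sub>v c \<in> K_space e" "v - R *\<^sub>v d \<in> K_space e" for u v c d
  proof -
    have "(u + v) - R *\<^sub>v (c + d) = (u - R *\<^sub>v c) + (v - R *\<^sub>v d)"
      unfolding vlinearD(2)[OF lin_R that(3,4)] using R that(1,2)
      by (intro eq_vecI) (auto simp del: index_mult_mat_vec simp: carrier_vecD)
    then show ?thesis using KD(3) that by simp
  qed
  have smult: "k \<cdot>\<^sub>v v - R *\<^sub>v (k \<cdot>\<^sub>v d) \<in> K_space e"
    if "v \<in> carrier_vec n" "d \<in> carrier_vec m" "v - R *\<^sub>v d \<in> K_space e" for k v d
  proof -
    have "k \<cdot>\<^sub>v v - R *\<^sub>v (k \<cdot>\<^sub>v d) = k \<cdot>\<^sub>v (v - R *\<^sub>v d)"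
      unfolding vlinearD(3)[OF lin_R that(2)] using R that(1)
      by (intro eq_vecI) (auto simp del: index_mult_mat_vec simp: carrier_vecD algebra_simps)
    then show ?thesis using KD(4) that by simp
  qed
  have "\<exists>G::complex mat. G \<in> carrier_mat m n \<and> (\<forall>v\<in>carrier_vec n. \<forall>c\<in>carrier_vec m.
      (v - R *\<^sub>v c \<in> K_space e) \<longleftrightarrow> c = G *\<^sub>v v)"
  proof (rule functional_relation_mat)
    show "\<exists>c\<in>carrier_vec m. v - R *\<^sub>v c \<in> K_space e" if "v \<in> carrier_vec n" for v
      using qb1[OF that] by blast
    show "c = d" if "v \<in> carrier_vec n" "c \<in> carrier_vec m" "d \<in> carrier_vec m"
      "v - R *\<^sub>v c \<in> K_space e" "v - R *\<^sub>v d \<in> K_space e" for v c d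
      using qb1[OF that(1)] that(2-) by blast
  qed (fact add smult)+
  then obtain G where "G \<in> carrier_mat m n"
    "\<And>v c. v \<in> carrier_vec n \<Longrightarrow> c \<in> carrier_vec m \<Longrightarrow> v - R *\<^sub>v c \<in> K_space e \<longleftrightarrow> c = G *\<^sub>v v"
    by blast
  then have "quotient_coordinates e m R G"
    using adm R unfolding n_def by (intro quotient_coordinates.intro)
  then show ?thesis by blast
qed

section \<open>Operators on tuples and their descent to the quotient\<close>

context quotient_coordinates
begin

abbreviation "N \<equiv> eq_size e"
abbreviation "q \<equiv> num_pts e"
abbreviation "n \<equiv> num_pts e * eq_size e"
abbreviation "A k \<equiv> res_mats e ! k"
abbreviation "K \<equiv> K_space e"

definition res_sum :: "complex vec \<Rightarrow> complex vec" where
  "res_sum v = vsum N (\<lambda>k. A k *\<^sub>v block N v k) {..<q}"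

text \<open>The spectral projections of \<open>T_op e\<close> on the space of tuples, before passing
  to the quotient: the \<open>k\<close>-th summand is the eigenspace for the \<open>k\<close>-th
  singular point.\<close>

definition comp_proj :: "nat \<Rightarrow> complex vec \<Rightarrow> complex vec" where
  "comp_proj k v = tuple q N (\<lambda>l. if l = k then block N v k else 0\<^sub>v N)"

definition diag_emb :: "complex vec \<Rightarrow> complex vec" where
  "diag_emb v = tuple q N (\<lambda>k. v)"

text \<open>Going up with \<open>R\<close>, applying an operator on tuples and returning with
  \<open>G\<close> is the operator in coordinates of the quotient. For \<open>comp_proj k\<close>
  this gives the spectral projections of the operator induced by \<open>T_op e\<close>.\<close>

definition F_mat :: "nat \<Rightarrow> complex mat" where
  "F_mat k = mat_of_fun m m (\<lambda>c. G *\<^sub>v comp_proj k (R *\<^sub>v c))"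

definition P_mat :: "complex mat" where
  "P_mat = mat_of_fun N m (\<lambda>v. G *\<^sub>v diag_emb v)"

definition Q_mat :: "complex mat" where
  "Q_mat = mat_of_fun m N (\<lambda>c. res_sum (R *\<^sub>v c))"

lemmas K = vsubspace_K_space[OF adm]
lemmas lin_A = vlinear_mat[OF admissibleD(5)[OF adm]]
lemmas lin_R = vlinear_mat[OF R_carrier]
lemmas lin_G = vlinear_mat[OF G_carrier]

lemma R_vec [simp]: "c \<in> carrier_vec m \<Longrightarrow> R *\<^sub>v c \<in> carrier_vec n"
  using mult_mat_vec_carrier[OF R_carrier] .

lemma G_vec [simp]: "v \<in> carrier_vec n \<Longrightarrow> G *\<^sub>v v \<in> carrier_vec m"
  using mult_mat_vec_carrier[OF G_carrier] .

lemma G_R: "c \<in> carrier_vec m \<Longrightarrow> G *\<^sub>v (R *\<^sub>v c) = c"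
  using G_iff[of "R *\<^sub>v c" c] vsubspaceD(2)[OF K] minus_cancel_vec[OF R_vec[of c]] by simp

lemma R_G: "v \<in> carrier_vec n \<Longrightarrow> v - R *\<^sub>v (G *\<^sub>v v) \<in> K"
  using G_iff[of v "G *\<^sub>v v"] by simp

lemma G_K: "v \<in> K \<Longrightarrow> G *\<^sub>v v = 0\<^sub>v m"
  using G_iff[of v "0\<^sub>v m"] vsubspaceD(1)[OF K, of v] vlinear_zero[OF lin_R] by simp

lemma A_vec [simp]: "k < q \<Longrightarrow> v \<in> carrier_vec N \<Longrightarrow> A k *\<^sub>v v \<in> carrier_vec N"
  using vlinearD(1)[OF lin_A] .

lemma lin_res_sum: "vlinear n N res_sum"
  unfolding res_sum_def[abs_def]
  by (rule vlinear_sum) (simp add: vlinear_comp[OF vlinear_block lin_A])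

lemma lin_comp_proj: "k < q \<Longrightarrow> vlinear n n (comp_proj k)"
  unfolding comp_proj_def[abs_def]
  by (rule vlinear_tuple, rename_tac l, case_tac "l = k") (auto simp: vlinear_const_zero vlinear_block)

lemma lin_diag_emb: "vlinear N n diag_emb"
  unfolding diag_emb_def[abs_def] by (rule vlinear_tuple) (simp add: vlinear_id)

lemma lin_T_op: "vlinear n n (T_op e)"
  unfolding T_op_def[abs_def] by (rule vlinear_tuple) (simp add: vlinear_smult vlinear_block)

lemma T_op_carrier [simp]: "T_op e v \<in> carrier_vec n"
  by (simp add: T_op_def)

lemma comp_proj_carrier [simp]: "comp_proj k v \<in> carrier_vec n"
  by (simp add: comp_proj_def)

lemma diag_emb_carrier [simp]: "diag_emb v \<in> carrier_vec n"
  by (simp add: diag_emb_def)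

lemma res_sum_carrier [simp]: "res_sum v \<in> carrier_vec N"
  by (simp add: res_sum_def)

lemma block_comp_proj: "l < q \<Longrightarrow> block N (comp_proj k v) l = (if l = k then block N v k else 0\<^sub>v N)"
  by (simp add: comp_proj_def block_tuple)

lemma block_diag_emb: "l < q \<Longrightarrow> v \<in> carrier_vec N \<Longrightarrow> block N (diag_emb v) l = v"
  by (simp add: diag_emb_def block_tuple)

lemma block_T_op: "l < q \<Longrightarrow> block N (T_op e v) l = sing_pts e ! l \<cdot>\<^sub>v block N v l"
  by (simp add: T_op_def block_tuple)

lemma comp_proj_comp_proj:
  "k < q \<Longrightarrow> l < q \<Longrightarrow> comp_proj k (comp_proj l v) = (if k = l then comp_proj k v else 0\<^sub>v n)"
  by (rule block_eqI[of _ q N]) (auto simp: block_comp_proj block_zero)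

lemma sum_comp_proj:
  assumes v: "v \<in> carrier_vec n"
  shows "vsum n (\<lambda>k. comp_proj k v) {..<q} = v"
proof (rule block_eqI[of _ q N, OF _ v])
  fix l assume l: "l < q"
  have "block N (vsum n (\<lambda>k. comp_proj k v) {..<q}) l
      = vsum N (\<lambda>k. block N (comp_proj k v) l) {..<q}"
    by (rule vlinear_vsum[OF vlinear_block[OF l]]) auto
  also have "\<dots> = block N (comp_proj l v) l"
    using l by (intro vsum_single) (auto simp: block_comp_proj)
  finally show "block N (vsum n (\<lambda>k. comp_proj k v) {..<q}) l = block N v l"
    using l by (simp add: block_comp_proj)
qed simp

lemma T_op_comp_proj: "k < q \<Longrightarrow> T_op e (comp_proj k v) = sing_pts e ! k \<cdot>\<^sub>v comp_proj k v"
  by (rule block_eqI[of _ q N])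
    (auto simp: block_T_op block_comp_proj vlinearD(3)[OF vlinear_block] smult_zero_vec_carrier)

lemma res_sum_comp_proj:
  assumes k: "k < q"
  shows "res_sum (comp_proj k v) = A k *\<^sub>v block N v k"
proof -
  have "res_sum (comp_proj k v) = A k *\<^sub>v block N (comp_proj k v) k"
    unfolding res_sum_def using k
    by (intro vsum_single) (auto simp: block_comp_proj vlinear_zero[OF lin_A])
  then show ?thesis using k by (simp add: block_comp_proj)
qed

lemma res_sum_K: "v \<in> K \<Longrightarrow> res_sum v = 0\<^sub>v N"
  unfolding res_sum_def K_space_iff[OF adm]
  by (intro eq_vecI) (auto simp: vsum_def simp del: index_mult_mat_vec)

lemma comp_proj_K: "k < q \<Longrightarrow> v \<in> K \<Longrightarrow> comp_proj k v \<in> K"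
  by (auto simp: K_space_iff[OF adm] block_comp_proj vlinear_zero[OF lin_A])

lemma T_op_K: "v \<in> K \<Longrightarrow> T_op e v \<in> K"
  by (auto simp: K_space_iff[OF adm] block_T_op vlinearD(3)[OF lin_A] smult_zero_vec_carrier)

text \<open>The matrix \<open>R\<close> is a section of the quotient map \<open>G\<close>, so
  \<open>R *\<^sub>v (G *\<^sub>v v)\<close> is another representative of the class of
  \<open>v\<close>. A linear map that vanishes on \<open>K\<close> does not distinguish the
  two.\<close>

lemma descend:
  assumes f: "vlinear n p f" and fK: "\<And>v. v \<in> K \<Longrightarrow> f v = 0\<^sub>v p" and v: "v \<in> carrier_vec n"
  shows "f (R *\<^sub>v (G *\<^sub>v v)) = f v"
proof -
  have "f v - f (R *\<^sub>v (G *\<^sub>v v)) = 0\<^sub>v p"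
    using fK[OF R_G[OF v]] vlinear_diff[OF f v] v by simp
  then show ?thesis using diff_eq_zero_vec_iff vlinearD(1)[OF f] v by (metis G_vec R_vec)
qed

text \<open>If \<open>f\<close> preserves \<open>K\<close>, then \<open>f\<close> followed by
  \<open>G\<close> vanishes on \<open>K\<close>, and \<open>descend\<close> applies. This is what
  makes induced operators compose.\<close>

lemma G_descend:
  assumes f: "vlinear n n f" and fK: "\<And>v. v \<in> K \<Longrightarrow> f v \<in> K" and v: "v \<in> carrier_vec n"
  shows "G *\<^sub>v f (R *\<^sub>v (G *\<^sub>v v)) = G *\<^sub>v f v"
  by (rule descend[OF vlinear_comp[OF f lin_G] _ v]) (simp add: G_K fK)

lemmas G_comp_proj = G_descend[OF lin_comp_proj comp_proj_K]
lemmas res_sum_RG = descend[OF lin_res_sum res_sum_K]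

lemma A_block_RG:
  assumes k: "k < q" and v: "v \<in> carrier_vec n"
  shows "A k *\<^sub>v block N (R *\<^sub>v (G *\<^sub>v v)) k = A k *\<^sub>v block N v k"
  by (rule descend[OF vlinear_comp[OF vlinear_block[OF k] lin_A[OF k]] _ v])
    (simp add: K_space_iff[OF adm] k)

lemma F_mat_vec:
  "k < q \<Longrightarrow> c \<in> carrier_vec m \<Longrightarrow> F_mat k *\<^sub>v c = G *\<^sub>v comp_proj k (R *\<^sub>v c)"
  unfolding F_mat_def
  by (rule mat_of_fun_mult[OF vlinear_comp[OF vlinear_comp[OF lin_R lin_comp_proj] lin_G]])

lemma P_mat_vec: "v \<in> carrier_vec N \<Longrightarrow> P_mat *\<^sub>v v = G *\<^sub>v diag_emb v"
  unfolding P_mat_def by (rule mat_of_fun_mult[OF vlinear_comp[OF lin_diag_emb lin_G]])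

lemma Q_mat_vec: "c \<in> carrier_vec m \<Longrightarrow> Q_mat *\<^sub>v c = res_sum (R *\<^sub>v c)"
  unfolding Q_mat_def by (rule mat_of_fun_mult[OF vlinear_comp[OF lin_R lin_res_sum]])

text \<open>By \<open>G_iff\<close> the condition on each column says that it equals
  \<open>G\<close> applied to \<open>f (col R k)\<close>. So for a fixed basis there is exactly one
  induced matrix, given by an explicit formula.\<close>

lemma induced_mat_iff:
  assumes f: "vlinear n n f"
  shows "induced_mat f K m R M \<longleftrightarrow> M = mat_of_fun m m (\<lambda>c. G *\<^sub>v f (R *\<^sub>v c))"
proof -
  define M' where "M' = mat_of_fun m m (\<lambda>c. G *\<^sub>v f (R *\<^sub>v c))"
  have M': "M' \<in> carrier_mat m m" by (simp add: M'_def)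
  have colM': "col M' k = G *\<^sub>v f (col R k)" if "k < m" for k
    unfolding M'_def col_mat_of_fun[OF vlinear_comp[OF vlinear_comp[OF lin_R f] lin_G] that]
      mat_mult_unit_vec[OF R_carrier that] ..
  have iff: "f (col R k) - R *\<^sub>v col M k \<in> K \<longleftrightarrow> col M k = col M' k"
    if "M \<in> carrier_mat m m" "k < m" for k
  proof -
    have "f (col R k) \<in> carrier_vec n"
      by (rule vlinearD(1)[OF f], rule carrier_vecI) (simp add: carrier_matD(1)[OF R_carrier])
    moreover have "col M k \<in> carrier_vec m"
      by (rule carrier_vecI) (simp add: carrier_matD(1)[OF that(1)])
    ultimately show ?thesis unfolding colM'[OF that(2)] by (rule G_iff)
  qed
  show ?thesis unfolding M'_def[symmetric]
  proof
    assume M: "induced_mat f K m R M"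
    show "M = M'"
    proof (rule mat_col_eqI)
      fix k assume "k < dim_col M'"
      then have k: "k < m" using M' by simp
      then show "col M k = col M' k" using M iff[of k] by (simp add: induced_mat_def)
    qed (use M M' in \<open>auto simp: induced_mat_def\<close>)
  next
    assume M: "M = M'"
    then have "f (col R k) - R *\<^sub>v col M k \<in> K" if "k < m" for k
      using iff[of k] that M' by simp
    then show "induced_mat f K m R M" using M M' by (simp add: induced_mat_def)
  qed
qed

lemma B_op_eq:
  assumes "eigenvalue (lead_mat e) \<alpha>" and v: "v \<in> carrier_vec n"
  shows "B_op e \<alpha> v = diag_emb ((-1) \<cdot>\<^sub>v (eigenproj (lead_mat e) \<alpha> *\<^sub>v res_sum v))"
proof -
  have "finsum_vec TYPE(complex) N (\<lambda>k. A k *\<^sub>v block N v k) {..<q} = res_sum v"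
    unfolding res_sum_def by (rule finsum_vec_eq_vsum) auto
  moreover have "- w = (-1) \<cdot>\<^sub>v w" for w :: "complex vec" by (intro eq_vecI) auto
  ultimately show ?thesis unfolding B_op_def Let_def diag_emb_def by simp
qed

interpretation S: spectral_resolution N "lead_mat e" "{\<alpha>. eigenvalue (lead_mat e) \<alpha>}" id
  "eigenproj (lead_mat e)"
  by (rule lead_resolution[OF adm])

lemma lin_B_op:
  assumes "eigenvalue (lead_mat e) \<alpha>"
  shows "vlinear n n (B_op e \<alpha>)"
proof (rule vlinear_cong)
  show "vlinear n n (\<lambda>v. diag_emb ((-1) \<cdot>\<^sub>v (eigenproj (lead_mat e) \<alpha> *\<^sub>v res_sum v)))"
    using assms by (intro vlinear_comp[OF vlinear_smult[OF vlinear_comp[OF lin_res_sum S.lin_E]] lin_diag_emb])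
      simp
qed (simp add: B_op_eq[OF assms])

text \<open>By \<open>B_op_eq\<close> the operator on tuples is a composite through vectors of
  length \<open>N\<close>: \<open>res_sum\<close>, then the negative spectral projection of
  \<open>S\<close>, then \<open>diag_emb\<close>. Its outer maps become \<open>Q_mat\<close> and
  \<open>P_mat\<close> in coordinates.\<close>

lemma induced_B_op:
  assumes \<alpha>: "eigenvalue (lead_mat e) \<alpha>" and B: "induced_mat (B_op e \<alpha>) K m R B"
  shows "B = - (P_mat * (eigenproj (lead_mat e) \<alpha> * Q_mat))"
proof (rule mat_eq_vecI[of _ m m])
  let ?E = "eigenproj (lead_mat e) \<alpha>"
  have P: "P_mat \<in> carrier_mat m N" and Q: "Q_mat \<in> carrier_mat N m" and E: "?E \<in> carrier_mat N N"
    using S.E_carrier \<alpha> by (auto simp: P_mat_def Q_mat_def)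
  have EQ: "?E * Q_mat \<in> carrier_mat N m" using E Q by simp
  show "- (P_mat * (?E * Q_mat)) \<in> carrier_mat m m" using P EQ by simp
  show "B \<in> carrier_mat m m" using B by (simp add: induced_mat_def)
  fix c :: "complex vec" assume c: "c \<in> carrier_vec m"
  have Ec: "?E *\<^sub>v res_sum (R *\<^sub>v c) \<in> carrier_vec N" using S.E_vec \<alpha> by simp
  have "B *\<^sub>v c = G *\<^sub>v B_op e \<alpha> (R *\<^sub>v c)"
    using B c unfolding induced_mat_iff[OF lin_B_op[OF \<alpha>]]
    by (simp add: mat_of_fun_mult[OF vlinear_comp[OF vlinear_comp[OF lin_R lin_B_op[OF \<alpha>]] lin_G]])
  also have "\<dots> = P_mat *\<^sub>v ((-1) \<cdot>\<^sub>v (?E *\<^sub>v (Q_mat *\<^sub>v c)))"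
    using c Ec by (simp add: B_op_eq[OF \<alpha>] P_mat_vec Q_mat_vec)
  also have "\<dots> = (-1) \<cdot>\<^sub>v ((P_mat * (?E * Q_mat)) *\<^sub>v c)"
    using c Ec P assoc_mult_mat_vec[OF P EQ c] assoc_mult_mat_vec[OF E Q c]
    by (simp add: mult_mat_vec[OF P] Q_mat_vec)
  also have "\<dots> = - ((P_mat * (?E * Q_mat)) *\<^sub>v c)" by (intro eq_vecI) auto
  also have "\<dots> = (- (P_mat * (?E * Q_mat))) *\<^sub>v c" using c Q by simp
  finally show "B *\<^sub>v c = (- (P_mat * (?E * Q_mat))) *\<^sub>v c" .
qed

section \<open>Minimality of the factorization obtained from the quotient\<close>

context
  fixes Tb :: "complex mat"
  assumes Tb: "induced_mat (T_op e) K m R Tb"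
begin

lemma Tb_vec: "c \<in> carrier_vec m \<Longrightarrow> Tb *\<^sub>v c = G *\<^sub>v T_op e (R *\<^sub>v c)"
  using Tb unfolding induced_mat_iff[OF lin_T_op]
  by (simp add: mat_of_fun_mult[OF vlinear_comp[OF vlinear_comp[OF lin_R lin_T_op] lin_G]])

text \<open>The space \<open>K\<close> is a direct sum of subspaces of the blocks, so it is
  preserved by \<open>comp_proj k\<close> and by \<open>T_op e\<close>, and the resolution on tuples
  descends. A projection becomes zero in the quotient when the corresponding residue is
  zero.\<close>

lemma Tb_resolution: "spectral_resolution m Tb {..<q} (\<lambda>k. sing_pts e ! k) F_mat"
proof
  show "inj_on ((!) (sing_pts e)) {..<q}"
    using admissibleD(4,6)[OF adm] by (auto simp: inj_on_def nth_eq_iff_index_eq)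
  show "Tb \<in> carrier_mat m m" using Tb by (simp add: induced_mat_def)
  show "F_mat k \<in> carrier_mat m m" for k by (simp add: F_mat_def)
  fix c :: "complex vec" assume c: "c \<in> carrier_vec m"
  have "vsum m (\<lambda>k. F_mat k *\<^sub>v c) {..<q} = vsum m (\<lambda>k. G *\<^sub>v comp_proj k (R *\<^sub>v c)) {..<q}"
    using c by (intro vsum_cong) (simp add: F_mat_vec)
  also have "\<dots> = G *\<^sub>v vsum n (\<lambda>k. comp_proj k (R *\<^sub>v c)) {..<q}"
    by (rule vlinear_vsum[OF lin_G, symmetric]) auto
  finally show "vsum m (\<lambda>k. F_mat k *\<^sub>v c) {..<q} = c" using c by (simp add: sum_comp_proj G_R)
  fix k assume "k \<in> {..<q}"
  then have k: "k < q" by simp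
  show "Tb *\<^sub>v (F_mat k *\<^sub>v c) = sing_pts e ! k \<cdot>\<^sub>v (F_mat k *\<^sub>v c)"
    using k c by (simp add: F_mat_vec Tb_vec G_descend[OF lin_T_op T_op_K] T_op_comp_proj
        vlinearD(3)[OF lin_G])
  fix l assume "l \<in> {..<q}"
  then show "F_mat k *\<^sub>v (F_mat l *\<^sub>v c) = (if k = l then F_mat k *\<^sub>v c else 0\<^sub>v m)"
    using k c by (simp add: F_mat_vec G_comp_proj comp_proj_comp_proj vlinear_zero[OF lin_G])
qed simp

text \<open>The factorization holds because \<open>res_sum\<close> of the \<open>k\<close>-th
  component of a constant tuple \<open>v\<close> is the \<open>k\<close>-th residue applied to
  \<open>v\<close>. Dividing by the kernels of the residues is exactly what makes it minimal: on
  classes supported in block \<open>k\<close> the map \<open>Q_mat\<close> is that residue, whose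
  kernel has become zero.\<close>

lemma realization_quotient: "realization e m Tb Q_mat P_mat"
proof -
  interpret T: spectral_resolution m Tb "{..<q}" "\<lambda>k. sing_pts e ! k" F_mat
    by (rule Tb_resolution)
  have F: "eigenproj Tb (sing_pts e ! k) = F_mat k" if "k < q" for k
    using T.eigenproj_eq that by simp
  have P: "P_mat \<in> carrier_mat m N" and Q: "Q_mat \<in> carrier_mat N m"
    by (auto simp: P_mat_def Q_mat_def)
  show ?thesis
  proof
    show "admissible e" by (rule adm)
    show "Tb \<in> carrier_mat m m" by (rule T.S_carrier)
    show "diagonalizable_mat Tb" by (rule T.diagonalizable)
    show "{\<alpha>. eigenvalue Tb \<alpha>} \<subseteq> set (sing_pts e)"
      using T.eigenvalue_in admissibleD(4)[OF adm] by (fastforce simp: in_set_conv_nth)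
    show "Q_mat \<in> carrier_mat N m" "P_mat \<in> carrier_mat m N" by (fact Q P)+
  next
    fix k assume k: "k < q"
    have Fk: "F_mat k \<in> carrier_mat m m" by (simp add: F_mat_def)
    have FP: "F_mat k * P_mat \<in> carrier_mat m N" using Fk P by simp
    show "A k = Q_mat * (eigenproj Tb (sing_pts e ! k) * P_mat)"
      unfolding F[OF k]
    proof (rule mat_eq_vecI[of _ N N])
      fix v :: "complex vec" assume v: "v \<in> carrier_vec N"
      have "(Q_mat * (F_mat k * P_mat)) *\<^sub>v v = Q_mat *\<^sub>v (F_mat k *\<^sub>v (P_mat *\<^sub>v v))"
        using assoc_mult_mat_vec[OF Q FP v] assoc_mult_mat_vec[OF Fk P v] by simp
      also have "\<dots> = res_sum (comp_proj k (R *\<^sub>v (G *\<^sub>v diag_emb v)))"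
        using v k by (simp add: P_mat_vec F_mat_vec Q_mat_vec res_sum_RG)
      also have "\<dots> = A k *\<^sub>v v"
        using v k by (simp add: res_sum_comp_proj A_block_RG block_diag_emb)
      finally show "A k *\<^sub>v v = (Q_mat * (F_mat k * P_mat)) *\<^sub>v v" by simp
    qed (use admissibleD(5)[OF adm k] Q FP in auto)
    fix w assume w: "w \<in> carrier_vec m" and eig: "Tb *\<^sub>v w = sing_pts e ! k \<cdot>\<^sub>v w"
    have Fw: "F_mat k *\<^sub>v w = w" using T.E_eigenvector(2)[OF w eig] k by simp
    then have Gw: "G *\<^sub>v comp_proj k (R *\<^sub>v w) = w" using F_mat_vec[OF k w] by simp
    show "\<exists>v\<in>carrier_vec N. w = eigenproj Tb (sing_pts e ! k) *\<^sub>v (P_mat *\<^sub>v v)"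
    \<comment> \<open>A class in the \<open>k\<close>-th eigenspace is represented by a tuple
      supported in block \<open>k\<close>. The constant tuple with that block as entry has the same
      \<open>k\<close>-th component.\<close>
    proof (rule bexI[of _ "block N (R *\<^sub>v w) k"])
      have "comp_proj k (diag_emb (block N (R *\<^sub>v w) k)) = comp_proj k (R *\<^sub>v w)"
        by (rule block_eqI[of _ q N]) (auto simp: block_comp_proj block_diag_emb)
      then show "w = eigenproj Tb (sing_pts e ! k) *\<^sub>v (P_mat *\<^sub>v block N (R *\<^sub>v w) k)"
        using Gw k by (simp add: F P_mat_vec F_mat_vec G_comp_proj)
    qed simp
    assume Q0: "Q_mat *\<^sub>v w = 0\<^sub>v N"
    have "Q_mat *\<^sub>v (G *\<^sub>v comp_proj k (R *\<^sub>v w)) = A k *\<^sub>v block N (R *\<^sub>v w) k"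
      using k by (simp add: Q_mat_vec res_sum_RG res_sum_comp_proj)
    then have "A k *\<^sub>v block N (R *\<^sub>v w) k = 0\<^sub>v N" using Q0 Gw by simp
    then have "comp_proj k (R *\<^sub>v w) \<in> K"
      using k by (auto simp: K_space_iff[OF adm] block_comp_proj vlinear_zero[OF lin_A])
    then show "w = 0\<^sub>v m" using G_K Gw by simp
  qed
qed

end

end

lemma induced_data_realization:
  assumes adm: "admissible e" and ind: "induced_data e \<alpha>s Tb Bs"
  shows "\<exists>M Q P. realization e M Tb Q P \<and>
    (\<forall>j<length \<alpha>s. Bs ! j = - (P * (eigenproj (lead_mat e) (\<alpha>s ! j) * Q)))"
proof -
  obtain m R where qb: "quotient_basis (num_pts e * eq_size e) (K_space e) m R"
    and T: "induced_mat (T_op e) (K_space e) m R Tb"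
    and B: "\<And>j. j < length \<alpha>s \<Longrightarrow> induced_mat (B_op e (\<alpha>s ! j)) (K_space e) m R (Bs ! j)"
    and \<alpha>s: "set \<alpha>s = {\<alpha>. eigenvalue (lead_mat e) \<alpha>}"
    using ind unfolding induced_data_def by blast
  obtain G where "quotient_coordinates e m R G"
    using quotient_basis_coordinates[OF adm qb] by blast
  then interpret quotient_coordinates e m R G .
  show ?thesis
  proof (intro exI conjI allI impI)
    show "realization e m Tb Q_mat P_mat" by (rule realization_quotient[OF T])
    fix j assume j: "j < length \<alpha>s"
    have "eigenvalue (lead_mat e) (\<alpha>s ! j)" using \<alpha>s nth_mem[OF j] by blast
    then show "Bs ! j = - (P_mat * (eigenproj (lead_mat e) (\<alpha>s ! j) * Q_mat))"
      using induced_B_op B[OF j] by blast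
  qed
qed

lemma ex_induced_data:
  assumes adm: "admissible e"
  shows "\<exists>\<alpha>s Tb Bs. induced_data e \<alpha>s Tb Bs"
proof -
  obtain m R where qb: "quotient_basis (num_pts e * eq_size e) (K_space e) m R"
    using ex_quotient_basis[OF vsubspace_K_space[OF adm]] by blast
  obtain G where "quotient_coordinates e m R G"
    using quotient_basis_coordinates[OF adm qb] by blast
  then interpret quotient_coordinates e m R G .
  obtain \<alpha>s where \<alpha>s: "set \<alpha>s = {\<alpha>. eigenvalue (lead_mat e) \<alpha>}" "distinct \<alpha>s"
    using finite_distinct_list[OF finite_eigenvalues[OF admissibleD(2)[OF adm]]] by blast
  define ind where "ind f = mat_of_fun m m (\<lambda>c. G *\<^sub>v f (R *\<^sub>v c))" for f
  have "induced_mat (T_op e) K m R (ind (T_op e))"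
    by (simp add: induced_mat_iff[OF lin_T_op] ind_def)
  moreover have "induced_mat (B_op e (\<alpha>s ! j)) K m R (map (\<lambda>\<alpha>. ind (B_op e \<alpha>)) \<alpha>s ! j)"
    if "j < length \<alpha>s" for j
  proof -
    have "eigenvalue (lead_mat e) (\<alpha>s ! j)" using \<alpha>s nth_mem[OF that] by blast
    then show ?thesis using that by (simp add: induced_mat_iff[OF lin_B_op] ind_def)
  qed
  ultimately have "induced_data e \<alpha>s (ind (T_op e)) (map (\<lambda>\<alpha>. ind (B_op e \<alpha>)) \<alpha>s)"
    unfolding induced_data_def using qb \<alpha>s by (intro conjI exI[of _ m] exI[of _ R]) auto
  then show ?thesis by blast
qed

section \<open>Inversion\<close>

text \<open>The two transforms differ only in the sign \<open>s\<close> of the singular points and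
  the opposite sign of the lead matrix. With this parameter both orders of composition become one
  statement: first \<open>s\<close>, then \<open>- s\<close>.\<close>

definition laplace_with :: "complex \<Rightarrow> equation \<Rightarrow> equation \<Rightarrow> bool" where
  "laplace_with s e e' \<longleftrightarrow> (\<exists>\<alpha>s Tb Bs. induced_data e \<alpha>s Tb Bs \<and>
     e' = \<lparr> lead_mat = - s \<cdot>\<^sub>m Tb, sing_pts = map ((*) s) \<alpha>s, res_mats = Bs \<rparr>)"

lemma mid_laplace_eq: "mid_laplace = laplace_with 1"
proof -
  have T: "- 1 \<cdot>\<^sub>m T = - T" for T :: "complex mat" by (intro eq_matI) auto
  have pts: "map ((*) 1) \<alpha>s = \<alpha>s" for \<alpha>s :: "complex list" by (rule map_idI) simp
  show ?thesis by (intro ext) (simp only: mid_laplace_def laplace_with_def T pts)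
qed

lemma inv_mid_laplace_eq: "inv_mid_laplace = laplace_with (- 1)"
proof -
  have T: "- (- 1) \<cdot>\<^sub>m T = T" for T :: "complex mat" by (intro eq_matI) auto
  have pts: "map ((*) (- 1)) \<alpha>s = map uminus \<alpha>s" for \<alpha>s :: "complex list"
    by (rule map_cong) simp_all
  show ?thesis by (intro ext) (simp only: inv_mid_laplace_def laplace_with_def T pts)
qed

text \<open>The transforms are relations, so without this the claim about all results of a composite
  could hold vacuously.\<close>

lemma ex_laplace_with:
  assumes "admissible e"
  shows "\<exists>e'. laplace_with s e e'"
  using ex_induced_data[OF assms] by (auto simp: laplace_with_def)

lemma laplace_with_dual:
  assumes adm: "admissible e" and irr: "irreducible_eq e" and nexc: "\<not> exceptional e"
    and s: "s \<noteq> 0" and lap: "laplace_with s e e'"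
  obtains M T Q P \<alpha>s where "dual_realization e M T Q P (- s) s \<alpha>s e'"
proof -
  obtain \<alpha>s T Bs where ind: "induced_data e \<alpha>s T Bs"
    and e': "e' = \<lparr> lead_mat = - s \<cdot>\<^sub>m T, sing_pts = map ((*) s) \<alpha>s, res_mats = Bs \<rparr>"
    using lap unfolding laplace_with_def by blast
  obtain M Q P where R: "realization e M T Q P"
    and Bs: "\<And>j. j < length \<alpha>s \<Longrightarrow> Bs ! j = - (P * (eigenproj (lead_mat e) (\<alpha>s ! j) * Q))"
    using induced_data_realization[OF adm ind] by blast
  have "dual_realization_axioms e T Q P (- s) s \<alpha>s e'"
    by unfold_locales (use ind irr nexc s Bs in \<open>auto simp: e' induced_data_def\<close>)
  then show ?thesis by (rule that[OF dual_realization.intro[OF R]])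
qed

text \<open>For comparing the pole parts: \<kappa> sends each pole that survives the double
  transform to its place in the original list, and the remaining original poles contribute
  zero.\<close>

lemma sum_nth_mono_neutral:
  fixes f :: "nat \<Rightarrow> complex"
  assumes "inj_on \<kappa> {..<l}" "\<kappa> ` {..<l} \<subseteq> {..<q}" "\<And>k. k < q \<Longrightarrow> k \<notin> \<kappa> ` {..<l} \<Longrightarrow> f k = 0"
  shows "(\<Sum>k<q. f k) = (\<Sum>j<l. f (\<kappa> j))"
proof -
  have "(\<Sum>j<l. f (\<kappa> j)) = (\<Sum>k\<in>\<kappa> ` {..<l}. f k)" using assms(1) by (simp add: sum.reindex)
  also have "\<dots> = (\<Sum>k<q. f k)" using assms(2,3) by (intro sum.mono_neutral_left) auto
  finally show ?thesis by simp
qed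

text \<open>The intermediate equation has two minimal factorizations: the dual of one for
  \<open>e\<close>, whose operator is \<open>s\<close> times \<open>S\<close>, and the one from
  which \<open>e''\<close> is computed. Uniqueness conjugates them, and the conjugating matrix is
  the gauge. Singular points are matched separately, since those with zero residue do not
  reappear.\<close>

lemma laplace_with_inverse:
  assumes adm: "admissible e" and irr: "irreducible_eq e" and nexc: "\<not> exceptional e"
    and s: "s * s = 1" and lap: "laplace_with s e e'" and lap': "laplace_with (- s) e' e''"
  shows "gauge_equiv e e''"
proof -
  have s0: "s \<noteq> 0" using s by auto
  have ss: "s * (s * x) = x" for x using s by (metis mult.assoc mult_1)
  obtain M T Q P \<alpha>s where "dual_realization e M T Q P (- s) s \<alpha>s e'"
    using laplace_with_dual[OF adm irr nexc s0 lap] by blast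
  then interpret D: dual_realization e M T Q P "- s" s \<alpha>s e' .
  obtain \<beta>s T' Bs where ind: "induced_data e' \<beta>s T' Bs"
    and e'': "e'' = \<lparr> lead_mat = s \<cdot>\<^sub>m T', sing_pts = map ((*) (- s)) \<beta>s, res_mats = Bs \<rparr>"
    using lap' unfolding laplace_with_def by auto
  obtain N' Q' P' where R': "realization e' N' T' Q' P'"
    and Bs: "\<And>j. j < length \<beta>s \<Longrightarrow> Bs ! j = - (P' * (eigenproj (lead_mat e') (\<beta>s ! j) * Q'))"
    using induced_data_realization[OF D.dual_admissible ind] by blast
  have \<beta>s: "distinct \<beta>s" "set \<beta>s = {\<beta>. eigenvalue (- s \<cdot>\<^sub>m T) \<beta>}" "length Bs = length \<beta>s"
    using ind by (auto simp: induced_data_def D.dual_lead)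
  define N where "N = eq_size e"
  define q where "q = num_pts e"
  define S where "S = lead_mat e"
  \<comment> \<open>Uniqueness is applied to the two factorizations of \<open>e'\<close>. The
    matrices act on vectors of length \<open>N\<close> because the dual factorization has
    \<open>S\<close>, up to the sign, as its operator.\<close>
  obtain G H where "N' = N" and G: "G \<in> carrier_mat N N" and H: "H \<in> carrier_mat N N"
    and GH: "G * H = 1\<^sub>m N" and HG: "H * G = 1\<^sub>m N" and T': "T' = G * (s \<cdot>\<^sub>m S) * H"
    and Q': "Q' = - P * H" and P': "P' = G * Q"
    using realizations_conjugate[OF D.realization_dual R', folded N_def S_def] by blast
  have S: "S \<in> carrier_mat N N" and Q: "Q \<in> carrier_mat N M" and P: "P \<in> carrier_mat M N"
    using D.S.S_carrier D.Q_carrier D.P_carrier by (auto simp: N_def S_def)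
  note A_carrier = admissibleD(5)[OF adm, folded N_def q_def]
  note scaled = D.T.scaled[OF D.nonzero(1)]
  \<comment> \<open>The lead matrix of \<open>e'\<close> is \<open>- s\<close> times
    \<open>T\<close>, so each of its eigenvalues comes from a singular point of \<open>e\<close>.
    The second transform multiplies by \<open>- s\<close> again and returns that point.\<close>
  have "\<exists>k<q. \<beta>s ! j = - s * sing_pts e ! k" if "j < length \<beta>s" for j
    using spectral_resolution.eigenvalue_in[OF scaled, of "\<beta>s ! j"] \<beta>s(2) nth_mem[OF that]
    by (auto simp: q_def)
  then obtain \<kappa> where \<kappa>: "\<And>j. j < length \<beta>s \<Longrightarrow> \<kappa> j < q"
    "\<And>j. j < length \<beta>s \<Longrightarrow> \<beta>s ! j = - s * sing_pts e ! \<kappa> j" by metis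
  have \<kappa>_inj: "inj_on \<kappa> {..<length \<beta>s}"
    using \<kappa>(2) \<beta>s(1) by (auto simp: inj_on_def) (metis nth_eq_iff_index_eq)
  have pts: "map ((*) (- s)) \<beta>s ! j = sing_pts e ! \<kappa> j" if "j < length \<beta>s" for j
    using \<kappa>(2)[OF that] that ss by simp
  have Bs_eq: "Bs ! j = G * res_mats e ! \<kappa> j * H" if j: "j < length \<beta>s" for j
  proof -
    define F where "F = D.F (\<kappa> j)"
    have k: "\<kappa> j < num_pts e" using \<kappa>(1)[OF j] by (simp add: q_def)
    have F: "F \<in> carrier_mat M M" using D.T.E_carrier k by (simp add: F_def)
    have "eigenproj (lead_mat e') (\<beta>s ! j) = F"
      using spectral_resolution.eigenproj_eq[OF scaled, of "\<kappa> j"] k \<kappa>(2)[OF j]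
      by (simp add: D.dual_lead F_def)
    then have "Bs ! j = - (G * Q * (F * (- P * H)))" using Bs[OF j] by (simp add: P' Q')
    \<comment> \<open>The minus sign of the second transform cancels the one that the dual
      factorization put into \<open>Q'\<close>.\<close>
    also have "\<dots> = G * Q * (F * (P * H))"
      using G Q F P H by simp
    also have "\<dots> = G * (Q * (F * P)) * H"
      using assoc_mult_mat[OF F P H] assoc_mult_mat[OF G Q mult_carrier_mat[OF F mult_carrier_mat[OF P H]]]
        assoc_mult_mat[OF Q mult_carrier_mat[OF F P] H]
        assoc_mult_mat[OF G mult_carrier_mat[OF Q mult_carrier_mat[OF F P]] H] by simp
    finally show ?thesis by (simp add: D.res_factor[OF k] F_def)
  qed
  \<comment> \<open>If the \<open>k\<close>-th point does not reappear, then
    \<open>- s * sing_pts e ! k\<close> is not an eigenvalue of the intermediate lead matrix. The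
    \<open>k\<close>-th spectral projection of \<open>T\<close> then has no nonzero value, and the
    residue factors through it.\<close>
  have A_zero: "res_mats e ! k = 0\<^sub>m N N" if k: "k < q" and nk: "k \<notin> \<kappa> ` {..<length \<beta>s}" for k
  proof (rule mat_eq_vecI[OF A_carrier[OF k]])
    fix v :: "complex vec" assume v: "v \<in> carrier_vec N"
    define w where "w = D.F k *\<^sub>v (P *\<^sub>v v)"
    have w: "w \<in> carrier_vec M" using k v by (simp add: w_def q_def N_def)
    have Tw: "(- s \<cdot>\<^sub>m T) *\<^sub>v w = (- s * sing_pts e ! k) \<cdot>\<^sub>v w"
      unfolding w_def using spectral_resolution.S_E[OF scaled, of k "P *\<^sub>v v"] k v
      by (simp add: q_def N_def)
    have "w = 0\<^sub>v M"
    proof (rule ccontr)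
      assume "w \<noteq> 0\<^sub>v M"
      then have "eigenvalue (- s \<cdot>\<^sub>m T) (- s * sing_pts e ! k)"
        using w Tw D.T_carrier by (auto simp: eigenvalue_def eigenvector_def intro!: exI[of _ w])
      then obtain j where j: "j < length \<beta>s" "\<beta>s ! j = - s * sing_pts e ! k"
        using \<beta>s(2) by (metis in_set_conv_nth mem_Collect_eq)
      then have "sing_pts e ! \<kappa> j = sing_pts e ! k" using \<kappa>(2)[OF j(1)] s0 by simp
      then have "\<kappa> j = k" using D.T.inj_a \<kappa>(1)[OF j(1)] k by (auto simp: q_def dest: inj_onD)
      then show False using nk j(1) by auto
    qed
    then have "res_mats e ! k *\<^sub>v v = 0\<^sub>v N"
      using D.A_vec[of k v] k v vlinear_zero[OF D.lin_Q] by (simp add: w_def q_def N_def)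
    also have "0\<^sub>v N = 0\<^sub>m N N *\<^sub>v v" using v by (intro eq_vecI) auto
    finally show "res_mats e ! k *\<^sub>v v = 0\<^sub>m N N *\<^sub>v v" .
  qed simp
  have lead: "s \<cdot>\<^sub>m T' = G * S * H"
  proof -
    have "T' = s \<cdot>\<^sub>m (G * S * H)"
      unfolding T' using G S H by (simp add: mult_smult_distrib mult_smult_assoc_mat[OF mult_carrier_mat[OF G S] H])
    moreover have "s \<cdot>\<^sub>m (s \<cdot>\<^sub>m X) = X" for X by (intro eq_matI) (auto simp: ss)
    ultimately show ?thesis by simp
  qed
  \<comment> \<open>The first argument of \<open>gauge\<close> is the inverse of the transforming
    matrix, so the gauge transformation is by \<open>H\<close>, with inverse
    \<open>G\<close>.\<close>
  let ?g = "gauge G H e"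
  have "same_eq ?g e''"
    unfolding same_eq_def
  proof (intro allI impI)
    fix x
    have size: "eq_size ?g = N" "eq_size e'' = N"
      using G by (auto simp: eq_size_def gauge_def e'' lead)
    have num: "num_pts ?g = q" "num_pts e'' = length \<beta>s"
      by (auto simp: num_pts_def gauge_def e'' q_def)
    show "coeff_mat ?g x = coeff_mat e'' x"
    proof (rule eq_matI)
      fix r t assume "r < dim_row (coeff_mat e'' x)" "t < dim_col (coeff_mat e'' x)"
      then have rt: "r < N" "t < N" by (auto simp: coeff_mat_def size)
      define f where "f k = (G * res_mats e ! k * H) $$ (r, t) / (x - sing_pts e ! k)" for k
      have "f k = 0" if "k < q" "k \<notin> \<kappa> ` {..<length \<beta>s}" for k
        unfolding f_def A_zero[OF that] using G H rt by simp
      then have "(\<Sum>k<q. f k) = (\<Sum>j<length \<beta>s. f (\<kappa> j))"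
        using \<kappa>_inj \<kappa>(1) by (intro sum_nth_mono_neutral) auto
      also have "\<dots> = (\<Sum>j<length \<beta>s. (Bs ! j) $$ (r, t) / (x - map ((*) (- s)) \<beta>s ! j))"
        by (intro sum.cong) (auto simp: f_def Bs_eq pts simp del: nth_map)
      finally have "(\<Sum>k<q. f k) = (\<Sum>j<length \<beta>s. (Bs ! j) $$ (r, t) / (x - map ((*) (- s)) \<beta>s ! j))" .
      moreover have "coeff_mat ?g x $$ (r, t) = (G * S * H) $$ (r, t) + (\<Sum>k<q. f k)"
        using rt admissibleD(3)[OF adm]
        by (simp add: coeff_mat_def size num) (simp add: gauge_def S_def f_def q_def)
      moreover have "coeff_mat e'' x $$ (r, t) = (G * S * H) $$ (r, t) +
        (\<Sum>j<length \<beta>s. (Bs ! j) $$ (r, t) / (x - map ((*) (- s)) \<beta>s ! j))"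
        using rt by (simp add: coeff_mat_def size num) (simp add: e'' lead)
      ultimately show "coeff_mat ?g x $$ (r, t) = coeff_mat e'' x $$ (r, t)" by simp
    qed (auto simp: coeff_mat_def size)
  qed
  moreover have "inverts_mat H G" "inverts_mat G H"
    using G H GH HG by (auto simp: inverts_mat_def)
  ultimately show ?thesis
    unfolding gauge_equiv_def N_def[symmetric] using G H by blast
qed

text \<open>For each order of composition two things are needed: some result exists, and every
  result, whatever bases and orderings were chosen, is gauge equivalent to the given equation. Both
  orders are instances of \<open>laplace_with\<close>, with \<open>s\<close> equal to 1 and to
  -1.\<close>

theorem theorem2p10:
  fixes e :: equation
  assumes "admissible e"
    and "irreducible_eq e"
    and "\<not> exceptional e"
  shows
    "((\<exists>e'. (mid_laplace OO inv_mid_laplace) e e') \<and> (\<forall>e'. (mid_laplace OO inv_mid_laplace) e e' \<longrightarrow> gauge_equiv e e') \<and>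
      (\<exists>e'. (inv_mid_laplace OO mid_laplace) e e') \<and> (\<forall>e'. (inv_mid_laplace OO mid_laplace) e e' \<longrightarrow> gauge_equiv e e')) \<and>
     (\<forall>e'. mid_laplace e e' \<or> inv_mid_laplace e e' \<longrightarrow>
        admissible e' \<and> irreducible_eq e' \<and> \<not> exceptional e')"
proof -
  have preserved: "admissible e' \<and> irreducible_eq e' \<and> \<not> exceptional e'"
    if "laplace_with s e e'" "s \<noteq> 0" for s e'
  proof -
    obtain M T Q P \<alpha>s where "dual_realization e M T Q P (- s) s \<alpha>s e'"
      using laplace_with_dual[OF assms \<open>s \<noteq> 0\<close> \<open>laplace_with s e e'\<close>] by blast
    then interpret dual_realization e M T Q P "- s" s \<alpha>s e' .
    show ?thesis using dual_admissible dual_irreducible dual_not_exceptional by blast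
  qed
  \<comment> \<open>The second transform has a result because the first one yields an admissible
    equation, which is part of \<open>preserved\<close>.\<close>
  have ex: "\<exists>e''. (laplace_with s OO laplace_with (- s)) e e''" if "s \<noteq> 0" for s
  proof -
    obtain e' where e': "laplace_with s e e'" using ex_laplace_with[OF assms(1)] by blast
    then show ?thesis using ex_laplace_with[of e' "- s"] preserved[OF e' that] by blast
  qed
  have inv: "gauge_equiv e e''" if "(laplace_with s OO laplace_with (- s)) e e''" "s * s = 1" for s e''
    using that laplace_with_inverse[OF assms] by blast
  show ?thesis
    unfolding mid_laplace_eq inv_mid_laplace_eq
    using ex[of 1] ex[of "-1"] inv[of 1] inv[of "-1"] preserved[of 1] preserved[of "-1"] by auto
qed

end
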